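(* Let $n\ge 2$, let $I\subset\mathbb{R}$ be a non-degenerate interval and let $\Gamma_\bullet: I\to \mathrm{Lo}_n^1$ be a smooth flag-convex curve. Then for any (non-empty) open subinterval $I_1\subset I$ there exists a matrix $L_1\in \mathrm{Lo}_n^1$ such that, for $\Gamma_1(t)=L_1\Gamma_\bullet(t)$ and $m_k=m_{\Gamma_1,k}$ ($1\le k\le n-1$), the following properties hold: (1) all roots of each $m_k$ in $I$ are simple and belong to $I_1$; (2) they are distinct: if $k_1\neq k_2$ then $m_{k_1}$ and $m_{k_2}$ have no common roots; (3) for each $k$, the function $m_k$ admits precisely $k(n-k)$ roots in $I$.
   Context: $\mathrm{Lo}_n^1$ is the group of real lower triangular $n\times n$ matrices with all diagonal entries equal to $1$. A smooth curve $\Gamma: I\to\mathrm{Lo}_n^1$ is flag-convex if for every $t\in I$ the matrix $A=(\Gamma(t))^{-1}\Gamma'(t)$ satisfies $A_{ij}>0$ whenever $i=j+1$ and $A_{ij}=0$ otherwise. For $L\in\mathrm{Lo}_n^1$ and $0<k<n$, $\mathrm{swminor}(L,k)$ is the $k\times k$ submatrix of $L$ formed by its last $k$ rows and first $k$ columns. For a flag-convex curve $\Gamma:I\to\mathrm{Lo}_n^1$, the function $m_{\Gamma,k}: I\to\mathbb{R}$ is $m_{\Gamma,k}(t)=\det(\mathrm{swminor}(\Gamma(t),k))$. *)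

theory Defs
  imports
    "HOL-Analysis.Derivative"
    "Jordan_Normal_Form.Determinant"
    "Jordan_Normal_Form.Gauss_Jordan_Elimination"
begin

(* Matrices are those of Jordan_Normal_Form, so rows and columns are numbered from 0. *)

definition Lo1 :: "nat \<Rightarrow> real mat set" where
  "Lo1 n = {L \<in> carrier_mat n n.
     (\<forall>i<n. L $$ (i, i) = 1) \<and> (\<forall>i<n. \<forall>j<n. i < j \<longrightarrow> L $$ (i, j) = 0)}"

(* C^infinity on I, where D k is the k-th derivative. Derivatives are taken within I, so they
   are one-sided at endpoints that belong to I. The notion is meant for non-degenerate
   intervals, on which such derivatives are unique. *)
definition smooth_on :: "real set \<Rightarrow> (real \<Rightarrow> real) \<Rightarrow> bool" where
  "smooth_on I f \<longleftrightarrow> (\<exists>D :: nat \<Rightarrow> real \<Rightarrow> real. (\<forall>t\<in>I. D 0 t = f t) \<and>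
     (\<forall>k. \<forall>t\<in>I. (D k has_real_derivative D (Suc k) t) (at t within I)))"

definition smooth_Lo1_curve :: "nat \<Rightarrow> real set \<Rightarrow> (real \<Rightarrow> real mat) \<Rightarrow> bool" where
  "smooth_Lo1_curve n I \<Gamma> \<longleftrightarrow> (\<forall>t\<in>I. \<Gamma> t \<in> Lo1 n) \<and>
     (\<forall>i<n. \<forall>j<n. smooth_on I (\<lambda>t. \<Gamma> t $$ (i, j)))"

definition mat_derivative :: "nat \<Rightarrow> real set \<Rightarrow> (real \<Rightarrow> real mat) \<Rightarrow> real \<Rightarrow> real mat" where
  "mat_derivative n I \<Gamma> t =
     mat n n (\<lambda>(i, j). vector_derivative (\<lambda>s. \<Gamma> s $$ (i, j)) (at t within I))"

(* The value of mat_inverse is never None here, since elements of Lo1 n are invertible. *)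
definition log_derivative :: "nat \<Rightarrow> real set \<Rightarrow> (real \<Rightarrow> real mat) \<Rightarrow> real \<Rightarrow> real mat" where
  "log_derivative n I \<Gamma> t = the (mat_inverse (\<Gamma> t)) * mat_derivative n I \<Gamma> t"

definition flag_convex :: "nat \<Rightarrow> real set \<Rightarrow> (real \<Rightarrow> real mat) \<Rightarrow> bool" where
  "flag_convex n I \<Gamma> \<longleftrightarrow> smooth_Lo1_curve n I \<Gamma> \<and>
     (\<forall>t\<in>I. \<forall>i<n. \<forall>j<n.
        if i = j + 1 then log_derivative n I \<Gamma> t $$ (i, j) > 0
        else log_derivative n I \<Gamma> t $$ (i, j) = 0)"

definition swminor :: "real mat \<Rightarrow> nat \<Rightarrow> real mat" where
  "swminor L k = mat k k (\<lambda>(i, j). L $$ (dim_row L - k + i, j))"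

definition m_curve :: "(real \<Rightarrow> real mat) \<Rightarrow> nat \<Rightarrow> real \<Rightarrow> real" where
  "m_curve \<Gamma> k t = det (swminor (\<Gamma> t) k)"

definition roots_on :: "real set \<Rightarrow> (real \<Rightarrow> real) \<Rightarrow> real set" where
  "roots_on I f = {t \<in> I. f t = 0}"

definition simple_root_on :: "real set \<Rightarrow> (real \<Rightarrow> real) \<Rightarrow> real \<Rightarrow> bool" where
  "simple_root_on I f t \<longleftrightarrow> t \<in> I \<and> f t = 0 \<and>
     (\<exists>d. d \<noteq> 0 \<and> (f has_real_derivative d) (at t within I))"

end

theory Submission
  imports Defs
begin

text \<open>
  Write \<open>m_k\<close> as the minor of \<open>L * \<Gamma> t\<close> on the last \<open>k\<close> rows and the first \<open>k\<close> columns. It is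
  convenient to look at all minors \<open>g_S\<close> on the last \<open>k\<close> rows at once, \<open>S\<close> being the set of columns.
  Since \<open>\<Gamma>' = \<Gamma> A\<close> with \<open>A\<close> concentrated on the subdiagonal, the derivative of \<open>g_S\<close> is a positive
  combination of the \<open>g_T\<close>, where \<open>T\<close> arises from \<open>S\<close> by moving one column one step to the right
  (\<open>minor_has_derivative\<close>). This linear system is triangular and does not depend on \<open>L\<close>; the matrix
  \<open>L\<close> enters only through initial values. Everything rests on this system.

  \<^item> If all \<open>g_S\<close> are positive at some time \<open>b\<close>, they stay positive after \<open>b\<close>; with signs
    \<open>(-1) ^ codepth\<close> the same holds before a time \<open>a\<close> (\<open>chain_system_pos_right\<close> and
    \<open>chain_system_pos_left\<close>). So the roots can be confined to a small interval \<open>[a, b]\<close> without any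
    knowledge of the rest of \<open>I\<close>, however long it is.

  \<^item> Fix \<open>t0\<close> in the open subinterval. Zooming in at \<open>t0\<close> by a factor \<open>s\<close>, and conjugating \<open>L\<close> by
    \<open>diag(1, s, s^2, ...)\<close> at the same time, turns the system as \<open>s \<rightarrow> 0\<close> into the one with constant
    coefficients \<open>A(t0)\<close>, whose solutions are polynomials; \<open>m_k\<close> becomes a polynomial of degree
    \<open>k * (n - k)\<close>. If these polynomials have \<open>k * (n - k)\<close> real roots, the roots are simple, and simple
    roots persist under \<open>C^1\<close>-small perturbations (\<open>simple_roots_stable\<close>); the sign conditions at the
    ends persist as well (\<open>fully_split_near\<close>).

  \<^item> For the polynomial system start with the identity matrix, where \<open>m_k\<close> is a multiple of the power
    \<open>t ^ (k * (n - k))\<close>, and multiply from the right by matrices \<open>I + e E\<close> with \<open>E\<close> a subdiagonal matrix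
    unit and \<open>e > 0\<close> small. For each \<open>k\<close> such a step either keeps the order of the zero of \<open>m_k\<close> at \<open>0\<close>
    or lowers it by one. In the second case the lowest term of \<open>m_k\<close>, whose
    coefficient is always positive, changes from degree \<open>d\<close> to degree \<open>d - 1\<close>. So the sign of \<open>m_k\<close> just
    to the left of \<open>0\<close> flips and a new negative root appears near \<open>0\<close>, while the roots found before
    survive. As long as the order is positive for some
    \<open>k\<close> there is a step that lowers it (\<open>split_stage_final_exists\<close>).

  \<^item> Finally, let \<open>u\<close> be a common root of \<open>m_k\<close> and \<open>m_l\<close> with \<open>k \<noteq> l\<close>. Replacing \<open>L * \<Gamma> u\<close> by
    \<open>L * \<Gamma> u * (I + d E)\<close>, where \<open>E\<close> has its entry in column \<open>k\<close> (counted from 1), keeps \<open>m_l(u) = 0\<close>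
    but makes \<open>m_k(u) \<noteq> 0\<close>, because \<open>u\<close> is a simple root of \<open>m_k\<close>. So a matrix whose minors have as many
    roots as possible in the union over all \<open>k\<close> has no common roots (\<open>fully_split_separate\<close>).
\<close>

section \<open>Column sequences and the raising operator\<close>

definition col_seqs :: "nat \<Rightarrow> nat \<Rightarrow> nat list set" where
  "col_seqs n k = {xs. length xs = k \<and> sorted_wrt (<) xs \<and> set xs \<subseteq> {..<n}}"

definition bump :: "nat list \<Rightarrow> nat \<Rightarrow> nat list" where
  "bump xs p = xs[p := Suc (xs ! p)]"

definition bumps :: "nat \<Rightarrow> nat list \<Rightarrow> nat set" where
  "bumps n xs = {p. p < length xs \<and> bump xs p \<in> col_seqs n (length xs)}"

text \<open>
  The infinitesimal action of a subdiagonal matrix with entries \<open>c\<close>, acting from the right, on the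
  vector of minors with a fixed set of rows. Bumps that would leave the range of columns or repeat a
  column contribute nothing to this action and are left out.
\<close>

definition raise :: "nat \<Rightarrow> (nat \<Rightarrow> real) \<Rightarrow> (nat list \<Rightarrow> real) \<Rightarrow> nat list \<Rightarrow> real" where
  "raise n c v xs = (\<Sum>p\<in>bumps n xs. c (xs ! p) * v (bump xs p))"

definition top_cols :: "nat \<Rightarrow> nat \<Rightarrow> nat list" where
  "top_cols n k = [n - k..<n]"

text \<open>
  The number of bumps that lead from \<open>xs\<close> to \<open>top_cols\<close>; it grades the
  vector of minors.
\<close>

definition codepth :: "nat \<Rightarrow> nat list \<Rightarrow> nat" where
  "codepth n xs = sum_list (top_cols n (length xs)) - sum_list xs"

text \<open>
  The transposed submatrix is used because the arguments below act on columns, and the Leibniz formula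
  then becomes a product over the positions of \<open>xs\<close>.
\<close>

definition minor :: "nat \<Rightarrow> nat \<Rightarrow> real mat \<Rightarrow> nat list \<Rightarrow> real" where
  "minor n k K xs = det (mat k k (\<lambda>(p, i). K $$ (n - k + i, xs ! p)))"

lemma finite_col_seqs: "finite (col_seqs n k)"
proof -
  have "col_seqs n k \<subseteq> {xs. set xs \<subseteq> {..<n} \<and> length xs = k}" by (auto simp: col_seqs_def)
  thus ?thesis using finite_lists_length_eq[of "{..<n}" k] finite_subset by blast
qed

lemma finite_bumps [simp]: "finite (bumps n xs)"
  by (auto simp: bumps_def)

lemma col_seqs_length_le:
  assumes "xs \<in> col_seqs n k"
  shows "k \<le> n"
proof -
  have "distinct xs" using assms strict_sorted_iff by (auto simp: col_seqs_def)
  hence "card (set xs) = k" using assms distinct_card by (auto simp: col_seqs_def)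
  moreover have "card (set xs) \<le> card {..<n}"
    using assms by (intro card_mono) (auto simp: col_seqs_def)
  ultimately show ?thesis by simp
qed

lemma col_seqs_strict:
  assumes "xs \<in> col_seqs n k" "p < q" "q < k"
  shows "xs ! p < xs ! q"
  using assms by (auto simp: col_seqs_def sorted_wrt_iff_nth_less)

lemma col_seqs_less:
  assumes "xs \<in> col_seqs n k" "p < k"
  shows "xs ! p < n"
  using assms nth_mem by (fastforce simp: col_seqs_def)

lemma col_seqs_gap:
  assumes "xs \<in> col_seqs n k" "p \<le> q" "q < k"
  shows "xs ! p + (q - p) \<le> xs ! q"
  using assms(2,3)
proof (induction q)
  case (Suc q)
  show ?case
  proof (cases "p = Suc q")
    case False
    hence "xs ! p + (q - p) \<le> xs ! q" using Suc by simp
    moreover have "xs ! q < xs ! Suc q" using col_seqs_strict[OF assms(1)] Suc.prems by simp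
    ultimately show ?thesis using False Suc.prems by linarith
  qed simp
qed simp

lemma col_seqs_upper:
  assumes "xs \<in> col_seqs n k" "p < k"
  shows "xs ! p \<le> n - k + p"
  using col_seqs_gap[OF assms(1), of p "k - 1"] col_seqs_less[OF assms(1), of "k - 1"] assms(2)
    col_seqs_length_le[OF assms(1)] by linarith

lemma col_seqs_lower:
  assumes "xs \<in> col_seqs n k" "p < k"
  shows "p \<le> xs ! p"
  using col_seqs_gap[OF assms(1), of 0 p] assms(2) by linarith

lemma col_seqsI:
  assumes "length xs = k" "\<And>p. Suc p < k \<Longrightarrow> xs ! p < xs ! Suc p" "\<And>p. p < k \<Longrightarrow> xs ! p < n"
  shows "xs \<in> col_seqs n k"
proof -
  have "sorted_wrt (<) xs"
    using assms(1,2) by (subst sorted_wrt_iff_nth_Suc_transp) (auto simp: transp_on_def)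
  thus ?thesis using assms(1,3) by (auto simp: col_seqs_def in_set_conv_nth)
qed

lemma top_cols_in: "k \<le> n \<Longrightarrow> top_cols n k \<in> col_seqs n k"
  by (auto simp: top_cols_def intro!: col_seqsI)

lemma bottom_cols_in: "k \<le> n \<Longrightarrow> [0..<k] \<in> col_seqs n k"
  by (auto intro!: col_seqsI)

lemma top_cols_nth: "k \<le> n \<Longrightarrow> p < k \<Longrightarrow> top_cols n k ! p = n - k + p"
  by (simp add: top_cols_def)

lemma sum_list_mono_nth:
  assumes "length xs = length ys" "\<And>p. p < length xs \<Longrightarrow> xs ! p \<le> (ys ! p :: nat)"
  shows "sum_list xs \<le> sum_list ys"
  using assms by (auto simp: sum_list_sum_nth intro!: sum_mono)

lemma col_seqs_sum_le:
  assumes "xs \<in> col_seqs n k"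
  shows "sum_list xs \<le> sum_list (top_cols n k)"
  using assms col_seqs_upper[OF assms] col_seqs_length_le[OF assms]
  by (intro sum_list_mono_nth) (auto simp: col_seqs_def top_cols_def)

lemma bump_col_seqs:
  assumes "xs \<in> col_seqs n k" "p \<in> bumps n xs"
  shows "p < k" "bump xs p \<in> col_seqs n k" "Suc (xs ! p) < n"
proof -
  show "p < k" and *: "bump xs p \<in> col_seqs n k" using assms by (auto simp: bumps_def col_seqs_def)
  show "Suc (xs ! p) < n" using col_seqs_less[OF * \<open>p < k\<close>] \<open>p < k\<close> assms(1)
    by (auto simp: bump_def col_seqs_def)
qed

lemma bump_sum:
  assumes "p < length xs"
  shows "sum_list (bump xs p) = Suc (sum_list xs)"
  using assms member_le_sum_list[of "xs ! p" xs] by (simp add: bump_def sum_list_update)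

lemma codepth_bump:
  assumes "xs \<in> col_seqs n k" "p \<in> bumps n xs"
  shows "codepth n xs = Suc (codepth n (bump xs p))"
  using bump_col_seqs[OF assms] bump_sum[of p xs] col_seqs_sum_le[OF assms(1)]
    col_seqs_sum_le[of "bump xs p" n k] assms(1) by (auto simp: codepth_def col_seqs_def)

lemma codepth_bottom:
  assumes "k \<le> n"
  shows "codepth n [0..<k] = k * (n - k)"
proof -
  have "sum_list (top_cols n k) = (\<Sum>p<k. (n - k) + p)"
    using assms by (simp add: sum_list_sum_nth top_cols_def atLeast0LessThan)
  also have "\<dots> = k * (n - k) + sum_list [0..<k]"
    by (simp add: sum.distrib sum_list_sum_nth atLeast0LessThan)
  finally show ?thesis by (simp add: codepth_def)
qed

text \<open>
  The Gale order on column sets is generated by bumps: the last position at which \<open>xs\<close> is smaller than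
  \<open>ys\<close> can be bumped, as everything to the right of it already agrees with \<open>ys\<close>.
\<close>

lemma bump_towards:
  assumes "xs \<in> col_seqs n k" "ys \<in> col_seqs n k" "\<And>p. p < k \<Longrightarrow> xs ! p \<le> ys ! p" "xs \<noteq> ys"
  obtains p where "p \<in> bumps n xs" "\<And>q. q < k \<Longrightarrow> bump xs p ! q \<le> ys ! q"
proof -
  have len: "length xs = k" "length ys = k" using assms by (auto simp: col_seqs_def)
  let ?S = "{p. p < k \<and> xs ! p < ys ! p}"
  have "?S \<noteq> {}" using assms(3,4) len by (metis (mono_tags, lifting) empty_iff le_neq_implies_less mem_Collect_eq nth_equalityI)
  \<comment> \<open>to the right of the last discrepancy the two sequences agree, so there is room for the bump\<close>
  define p where "p = Max ?S"
  have "p \<in> ?S" unfolding p_def using \<open>?S \<noteq> {}\<close> by (intro Max_in) auto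
  hence p: "p < k" "xs ! p < ys ! p" by auto
  have above: "xs ! q = ys ! q" if "p < q" "q < k" for q
  proof -
    have "q \<notin> ?S" using Max_ge[of ?S q] that(1) unfolding p_def by fastforce
    thus ?thesis using assms(3)[OF that(2)] that(2) by auto
  qed
  have le: "bump xs p ! q \<le> ys ! q" if "q < k" for q
    using that assms(3) p len by (auto simp: bump_def nth_list_update)
  have "bump xs p \<in> col_seqs n k"
  proof (rule col_seqsI)
    fix q assume q: "Suc q < k"
    have "xs ! q < xs ! Suc q" using col_seqs_strict[OF assms(1)] q by simp
    moreover have "Suc (xs ! p) < xs ! Suc p" if "p = q"
      using above[of "Suc p"] col_seqs_strict[OF assms(2), of p "Suc p"] p(2) that q by simp
    ultimately show "bump xs p ! q < bump xs p ! Suc q"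
      using q len p by (auto simp: bump_def nth_list_update)
  next
    fix q assume "q < k"
    thus "bump xs p ! q < n" using le[of q] col_seqs_less[OF assms(2), of q] by simp
  qed (simp add: bump_def len)
  hence "p \<in> bumps n xs" using p len by (auto simp: bumps_def)
  thus thesis using that le by blast
qed

lemma raise_power_Suc:
  "(raise n c ^^ Suc m) v xs = (\<Sum>p\<in>bumps n xs. c (xs ! p) * (raise n c ^^ m) v (bump xs p))"
  by (simp add: raise_def[of n c "(raise n c ^^ m) v"])

lemma raise_nonneg:
  assumes "xs \<in> col_seqs n k" "\<And>ys. ys \<in> col_seqs n k \<Longrightarrow> 0 \<le> v ys" "\<And>j. Suc j < n \<Longrightarrow> 0 \<le> c j"
  shows "0 \<le> raise n c v xs"
  unfolding raise_def using assms bump_col_seqs[OF assms(1)] by (intro sum_nonneg mult_nonneg_nonneg) auto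

lemma raise_power_nonneg:
  assumes "xs \<in> col_seqs n k" "\<And>ys. ys \<in> col_seqs n k \<Longrightarrow> 0 \<le> v ys" "\<And>j. Suc j < n \<Longrightarrow> 0 \<le> c j"
  shows "0 \<le> (raise n c ^^ m) v xs"
  using assms(1) by (induction m arbitrary: xs) (auto intro!: raise_nonneg assms)

text \<open>
  Raising respects the grading, so only the part of \<open>v\<close> of one codepth is seen.
\<close>

lemma raise_power_eq_0:
  assumes "xs \<in> col_seqs n k" "\<And>ys. ys \<in> col_seqs n k \<Longrightarrow> codepth n ys + m = codepth n xs \<Longrightarrow> v ys = 0"
  shows "(raise n c ^^ m) v xs = 0"
  using assms
proof (induction m arbitrary: xs)
  case (Suc m)
  have "(raise n c ^^ m) v (bump xs p) = 0" if "p \<in> bumps n xs" for p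
    using Suc.IH[of "bump xs p"] bump_col_seqs(2)[OF Suc.prems(1) that]
      codepth_bump[OF Suc.prems(1) that] Suc.prems(2) by simp
  thus ?case by (simp add: raise_power_Suc del: funpow.simps)
qed auto

text \<open>
  No cancellation occurs between non-negative numbers, so one path of bumps from \<open>xs\<close> to a set \<open>ys\<close> with
  positive value is enough.
\<close>

lemma raise_power_pos:
  assumes "xs \<in> col_seqs n k" "ys \<in> col_seqs n k" "\<And>p. p < k \<Longrightarrow> xs ! p \<le> ys ! p"
    "codepth n ys + m = codepth n xs" "v ys > 0"
    "\<And>ys. ys \<in> col_seqs n k \<Longrightarrow> 0 \<le> v ys" "\<And>j. Suc j < n \<Longrightarrow> 0 < c j"
  shows "(raise n c ^^ m) v xs > 0"
  using assms(1,3,4)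
proof (induction m arbitrary: xs)
  case 0
  have "xs = ys"
  proof (rule ccontr)
    assume "xs \<noteq> ys"
    obtain p where p: "p \<in> bumps n xs" and le: "\<And>q. q < k \<Longrightarrow> bump xs p ! q \<le> ys ! q"
      using bump_towards[OF 0(1) assms(2) 0(2) \<open>xs \<noteq> ys\<close>] by blast
    have "sum_list (bump xs p) \<le> sum_list ys"
      using le bump_col_seqs(2)[OF 0(1) p] assms(2) by (intro sum_list_mono_nth) (auto simp: col_seqs_def)
    hence "codepth n ys \<le> codepth n (bump xs p)"
      using bump_col_seqs(2)[OF 0(1) p] assms(2) by (auto simp: codepth_def col_seqs_def)
    thus False using codepth_bump[OF 0(1) p] 0(3) by simp
  qed
  thus ?case using assms(5) by simp
next
  case (Suc m)
  have "xs \<noteq> ys" using Suc.prems(3) by auto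
  obtain p where p: "p \<in> bumps n xs" and le: "\<And>q. q < k \<Longrightarrow> bump xs p ! q \<le> ys ! q"
    using bump_towards[OF Suc.prems(1) assms(2) Suc.prems(2) \<open>xs \<noteq> ys\<close>] by blast
  have "0 < (raise n c ^^ m) v (bump xs p)"
    using Suc.IH[of "bump xs p"] le bump_col_seqs(2)[OF Suc.prems(1) p] codepth_bump[OF Suc.prems(1) p] Suc.prems(3)
    by simp
  hence "0 < c (xs ! p) * (raise n c ^^ m) v (bump xs p)"
    using assms(7) bump_col_seqs(3)[OF Suc.prems(1) p] by simp
  moreover have "0 \<le> c (xs ! q) * (raise n c ^^ m) v (bump xs q)" if q: "q \<in> bumps n xs" for q
    using assms(7) bump_col_seqs(3)[OF Suc.prems(1) q]
      raise_power_nonneg[OF bump_col_seqs(2)[OF Suc.prems(1) q], where v = v and c = c and m = m] assms(6)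
    by (intro mult_nonneg_nonneg) (auto intro: less_imp_le)
  ultimately have "0 < (\<Sum>p\<in>bumps n xs. c (xs ! p) * (raise n c ^^ m) v (bump xs p))"
    using p by (intro sum_pos2) auto
  thus ?case by (simp add: raise_power_Suc del: funpow.simps)
qed

section \<open>Minors on the last rows\<close>

lemma minor_expand:
  "minor n k K xs = (\<Sum>q\<in>{q. q permutes {0..<k}}. signof q * (\<Prod>p = 0..<k. K $$ (n - k + q p, xs ! p)))"
proof -
  have "minor n k K xs = (\<Sum>q\<in>{q. q permutes {0..<k}}. signof q *
      (\<Prod>p = 0..<k. mat k k (\<lambda>(p, i). K $$ (n - k + i, xs ! p)) $$ (p, q p)))"
    unfolding minor_def by (intro det_def') simp
  also have "\<dots> = (\<Sum>q\<in>{q. q permutes {0..<k}}. signof q * (\<Prod>p = 0..<k. K $$ (n - k + q p, xs ! p)))"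
  proof (intro sum.cong arg_cong2[of _ _ _ _ "(*)"] prod.cong refl)
    fix q p assume "q \<in> {q. q permutes {0..<k}}" "p \<in> {0..<k}"
    hence "q p < k" using permutes_in_image[of q "{0..<k}" p] by simp
    thus "mat k k (\<lambda>(p, i). K $$ (n - k + i, xs ! p)) $$ (p, q p) = K $$ (n - k + q p, xs ! p)"
      using \<open>p \<in> _\<close> by simp
  qed
  finally show ?thesis .
qed

lemma minor_repeated:
  assumes "p < k" "q < k" "p \<noteq> q" "xs ! p = xs ! q"
  shows "minor n k K xs = 0"
  unfolding minor_def using assms
  by (intro det_identical_rows[of _ k p q]) (auto intro!: eq_vecI)

lemma minor_cong:
  assumes "k \<le> n" "\<And>i p. i < n \<Longrightarrow> p < k \<Longrightarrow> K $$ (i, xs ! p) = K' $$ (i, xs ! p)"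
  shows "minor n k K xs = minor n k K' xs"
  unfolding minor_def using assms by (intro arg_cong[of _ _ det] eq_matI) auto

lemma minor_swminor:
  assumes "K \<in> carrier_mat n n" "k \<le> n"
  shows "det (swminor K k) = minor n k K [0..<k]"
proof -
  have "det (swminor K k) = det (swminor K k)\<^sup>T"
    by (rule det_transpose[symmetric, of _ k]) (simp add: swminor_def)
  also have "(swminor K k)\<^sup>T = mat k k (\<lambda>(p, i). K $$ (n - k + i, [0..<k] ! p))"
    using assms by (intro eq_matI) (auto simp: swminor_def)
  finally show ?thesis by (simp add: minor_def)
qed

text \<open>
  Differentiate the Leibniz formula column by column: column \<open>xs ! p\<close> is replaced by a multiple of its
  right neighbour, which gives the minor on \<open>bump xs p\<close>. This vanishes if the neighbour is already among
  the columns of \<open>xs\<close>, and the term is absent for the last column.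
\<close>

lemma minor_has_derivative:
  fixes K :: "real \<Rightarrow> real mat"
  assumes K: "\<And>i j. i < n \<Longrightarrow> j < n \<Longrightarrow>
      ((\<lambda>t. K t $$ (i, j)) has_real_derivative (if Suc j < n then c j * K t $$ (i, Suc j) else 0)) (at t within J)"
    and xs: "xs \<in> col_seqs n k"
  shows "((\<lambda>t. minor n k (K t) xs) has_real_derivative raise n c (minor n k (K t)) xs) (at t within J)"
proof -
  have k: "k \<le> n" and len: "length xs = k" using col_seqs_length_le xs by (auto simp: col_seqs_def)
  define d where "d j = (if Suc j < n then c j else 0)" for j
  define E where "E q p t = K t $$ (n - k + q p, xs ! p)" for q p t
  define E' where "E' q p = d (xs ! p) * K t $$ (n - k + q p, Suc (xs ! p))" for q p
  let ?P = "{q. q permutes {0..<k}}"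
  have E: "(E q p has_real_derivative E' q p) (at t within J)" if "q \<in> ?P" "p \<in> {0..<k}" for q p
  proof -
    have "q p < k" using that permutes_in_image[of q "{0..<k}" p] by simp
    hence "n - k + q p < n" using k by simp
    thus ?thesis using K[of "n - k + q p" "xs ! p"] col_seqs_less[OF xs, of p] that
      unfolding E_def E'_def d_def by (auto simp del: add_diff_assoc2)
  qed
  have prod: "((\<lambda>t. \<Prod>p = 0..<k. E q p t) has_real_derivative
      (\<Sum>p = 0..<k. E' q p * (\<Prod>r\<in>{0..<k} - {p}. E q r t))) (at t within J)" if "q \<in> ?P" for q
  proof -
    have "((\<lambda>t. \<Prod>p = 0..<k. E q p t) has_derivative
      (\<lambda>y. \<Sum>p = 0..<k. (E' q p * y) * (\<Prod>r\<in>{0..<k} - {p}. E q r t))) (at t within J)"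
      using E[OF that] by (intro has_derivative_prod) (auto simp: has_field_derivative_def)
    thus ?thesis unfolding has_field_derivative_def
      by (rule has_derivative_eq_rhs) (simp add: fun_eq_iff sum_distrib_left sum_distrib_right mult_ac)
  qed
  have summand: "E' q p * (\<Prod>r\<in>{0..<k} - {p}. E q r t) =
      d (xs ! p) * (\<Prod>r = 0..<k. K t $$ (n - k + q r, bump xs p ! r))" if p: "p \<in> {0..<k}" for q p
  proof -
    have "(\<Prod>r = 0..<k. K t $$ (n - k + q r, bump xs p ! r)) =
       K t $$ (n - k + q p, bump xs p ! p) * (\<Prod>r\<in>{0..<k} - {p}. K t $$ (n - k + q r, bump xs p ! r))"
      using p by (subst prod.remove[of _ p]) auto
    also have "(\<Prod>r\<in>{0..<k} - {p}. K t $$ (n - k + q r, bump xs p ! r)) = (\<Prod>r\<in>{0..<k} - {p}. E q r t)"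
      unfolding E_def by (intro prod.cong) (auto simp: bump_def)
    finally show ?thesis using p len by (simp add: E'_def bump_def)
  qed
  have "((\<lambda>t. \<Sum>q\<in>?P. signof q * (\<Prod>p = 0..<k. E q p t)) has_real_derivative
      (\<Sum>q\<in>?P. signof q * (\<Sum>p = 0..<k. E' q p * (\<Prod>r\<in>{0..<k} - {p}. E q r t)))) (at t within J)"
    by (intro DERIV_sum DERIV_cmult prod)
  also have "(\<lambda>t. \<Sum>q\<in>?P. signof q * (\<Prod>p = 0..<k. E q p t)) = (\<lambda>t. minor n k (K t) xs)"
    by (simp add: minor_expand E_def)
  also have "(\<Sum>q\<in>?P. signof q * (\<Sum>p = 0..<k. E' q p * (\<Prod>r\<in>{0..<k} - {p}. E q r t))) =
      (\<Sum>q\<in>?P. \<Sum>p = 0..<k. d (xs ! p) * (signof q * (\<Prod>r = 0..<k. K t $$ (n - k + q r, bump xs p ! r))))"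
    by (simp add: sum_distrib_left summand mult_ac)
  also have "\<dots> = (\<Sum>p = 0..<k. d (xs ! p) * minor n k (K t) (bump xs p))"
    by (subst sum.swap) (simp add: minor_expand sum_distrib_left)
  also have "\<dots> = raise n c (minor n k (K t)) xs"
    unfolding raise_def
  proof (rule sum.mono_neutral_cong_right)
    show "bumps n xs \<subseteq> {0..<k}" using bump_col_seqs[OF xs] by auto
    show "\<forall>p\<in>{0..<k} - bumps n xs. d (xs ! p) * minor n k (K t) (bump xs p) = 0"
    proof
      fix p assume p: "p \<in> {0..<k} - bumps n xs"
      show "d (xs ! p) * minor n k (K t) (bump xs p) = 0"
      proof (cases "Suc (xs ! p) < n")
        case True
        have "\<exists>q. Suc q < k \<and> \<not> bump xs p ! q < bump xs p ! Suc q"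
        proof (rule ccontr)
          assume "\<not> ?thesis"
          hence "bump xs p \<in> col_seqs n k" using True col_seqs_less[OF xs] len p
            by (intro col_seqsI) (auto simp: bump_def nth_list_update)
          thus False using p len by (auto simp: bumps_def)
        qed
        then obtain q where q: "Suc q < k" "\<not> bump xs p ! q < bump xs p ! Suc q" by blast
        have "xs ! q < xs ! Suc q" using col_seqs_strict[OF xs, of q "Suc q"] q by simp
        hence "bump xs p ! q = bump xs p ! Suc q"
          using q len p by (auto simp: bump_def nth_list_update split: if_splits)
        hence "minor n k (K t) (bump xs p) = 0"
          using q by (intro minor_repeated[of q k "Suc q"]) auto
        thus ?thesis by simp
      qed (simp add: d_def)
    qed
    show "d (xs ! p) * minor n k (K t) (bump xs p) = c (xs ! p) * minor n k (K t) (bump xs p)"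
      if "p \<in> bumps n xs" for p
      using bump_col_seqs(3)[OF xs that] by (simp add: d_def)
  qed simp
  finally show ?thesis .
qed

text \<open>
  Right multiplication by this matrix adds \<open>e\<close> times column \<open>j + 1\<close> to column \<open>j\<close>.
\<close>

definition elementary :: "nat \<Rightarrow> nat \<Rightarrow> real \<Rightarrow> real mat" where
  "elementary n j e = mat n n (\<lambda>(i, l). if i = l then 1 else if i = Suc j \<and> l = j then e else 0)"

lemma elementary_Lo1: "elementary n j e \<in> Lo1 n"
  by (auto simp: elementary_def Lo1_def)

lemma mult_elementary_index:
  assumes "K \<in> carrier_mat n n" "i < n" "l < n" "Suc j < n"
  shows "(K * elementary n j e) $$ (i, l) = K $$ (i, l) + (if l = j then e * K $$ (i, Suc j) else 0)"
proof -
  have "(K * elementary n j e) $$ (i, l) = (\<Sum>m = 0..<n. K $$ (i, m) * elementary n j e $$ (m, l))"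
    using assms by (simp add: scalar_prod_def elementary_def)
  also have "\<dots> = (\<Sum>m = 0..<n. (if m = l then K $$ (i, l) else 0) +
      (if m = Suc j then (if l = j then e * K $$ (i, Suc j) else 0) else 0))"
    using assms by (intro sum.cong) (auto simp: elementary_def)
  also have "\<dots> = K $$ (i, l) + (if l = j then e * K $$ (i, Suc j) else 0)"
    using assms by (simp add: sum.distrib)
  finally show ?thesis .
qed

text \<open>
  As a function of \<open>e\<close> the left-hand side is a curve with subdiagonal logarithmic derivative, so its
  derivative is known from \<open>minor_has_derivative\<close>. The derivative is constant, because a column set that
  has just been bumped at \<open>j\<close> does not contain \<open>j\<close> and does not see the column operation.
\<close>

lemma minor_mult_elementary:
  assumes K: "K \<in> carrier_mat n n" and j: "Suc j < n" and xs: "xs \<in> col_seqs n k"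
  shows "minor n k (K * elementary n j e) xs =
    minor n k K xs + e * raise n (\<lambda>l. if l = j then 1 else 0) (minor n k K) xs"
proof -
  let ?c = "\<lambda>l. if l = j then 1 else 0 :: real"
  let ?D = "raise n ?c (minor n k K) xs"
  have k: "k \<le> n" and len: "length xs = k" using col_seqs_length_le xs by (auto simp: col_seqs_def)
  have const: "raise n ?c (minor n k (K * elementary n j t)) xs = ?D" for t
    unfolding raise_def
  proof (intro sum.cong refl)
    fix p assume p: "p \<in> bumps n xs"
    show "?c (xs ! p) * minor n k (K * elementary n j t) (bump xs p) = ?c (xs ! p) * minor n k K (bump xs p)"
    proof (cases "xs ! p = j")
      case True
      have "minor n k (K * elementary n j t) (bump xs p) = minor n k K (bump xs p)"
      proof (rule minor_cong[OF k])
        fix i q assume "i < n" "q < k"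
        have "bump xs p ! q \<noteq> j"
        proof (cases "q = p")
          case False
          hence "xs ! q \<noteq> xs ! p"
            using col_seqs_strict[OF xs, of p q] col_seqs_strict[OF xs, of q p] \<open>q < k\<close> bump_col_seqs(1)[OF xs p]
            by (cases "p < q") auto
          thus ?thesis using False True by (simp add: bump_def)
        qed (use True len \<open>q < k\<close> in \<open>simp add: bump_def\<close>)
        moreover have "bump xs p ! q < n" using col_seqs_less[OF bump_col_seqs(2)[OF xs p] \<open>q < k\<close>] .
        ultimately show "(K * elementary n j t) $$ (i, bump xs p ! q) = K $$ (i, bump xs p ! q)"
          using \<open>i < n\<close> j K by (subst mult_elementary_index) auto
      qed
      thus ?thesis by simp
    qed simp
  qed
  have D: "((\<lambda>t. minor n k (K * elementary n j t) xs) has_real_derivative ?D) (at t)" for t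
    unfolding const[of t, symmetric]
  proof (rule minor_has_derivative[OF _ xs])
    fix i l assume il: "i < n" "l < n"
    have "((\<lambda>t. K $$ (i, l) + (if l = j then t * K $$ (i, Suc j) else 0)) has_real_derivative
        (if l = j then K $$ (i, Suc j) else 0)) (at t)"
      by (auto intro!: derivative_eq_intros)
    also have "(\<lambda>t. K $$ (i, l) + (if l = j then t * K $$ (i, Suc j) else 0)) = (\<lambda>t. (K * elementary n j t) $$ (i, l))"
      using mult_elementary_index[OF K il j] by auto
    also have "(if l = j then K $$ (i, Suc j) else 0) =
        (if Suc l < n then (if l = j then 1 else 0) * (K * elementary n j t) $$ (i, Suc l) else 0)"
      using mult_elementary_index[OF K il(1) j j, of t] j by auto
    finally show "((\<lambda>t. (K * elementary n j t) $$ (i, l)) has_real_derivative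
        (if Suc l < n then (if l = j then 1 else 0) * (K * elementary n j t) $$ (i, Suc l) else 0)) (at t)" .
  qed
  have "((\<lambda>t. minor n k (K * elementary n j t) xs - t * ?D) has_real_derivative 0) (at t)" for t
    by (rule derivative_eq_intros D refl | simp)+
  hence "minor n k (K * elementary n j e) xs - e * ?D = minor n k (K * elementary n j 0) xs - 0 * ?D"
    by (intro DERIV_isconst_all) blast
  also have "minor n k (K * elementary n j 0) xs = minor n k K xs"
    using mult_elementary_index[OF K _ _ j, of _ _ 0] col_seqs_less[OF xs] by (intro minor_cong k) auto
  finally show ?thesis by simp
qed

lemma minor_top:
  assumes "L \<in> Lo1 n" "k \<le> n"
  shows "minor n k L (top_cols n k) = 1"
proof -
  let ?A = "mat k k (\<lambda>(p, i). L $$ (n - k + i, top_cols n k ! p))"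
  have "det ?A = prod_list (diag_mat ?A)"
  proof (rule det_upper_triangular)
    show "upper_triangular ?A" using assms by (auto simp: Lo1_def top_cols_nth)
    show "?A \<in> carrier_mat k k" by simp
  qed
  also have "diag_mat ?A = map (\<lambda>i. 1) [0..<k]"
    unfolding diag_mat_def using assms by (auto simp: Lo1_def top_cols_nth)
  finally show ?thesis by (simp add: minor_def map_replicate_const)
qed

lemma minor_one:
  assumes "xs \<in> col_seqs n k" "xs \<noteq> top_cols n k"
  shows "minor n k (1\<^sub>m n) xs = 0"
proof -
  have k: "k \<le> n" and len: "length xs = k" using col_seqs_length_le assms by (auto simp: col_seqs_def)
  obtain p where "p \<in> bumps n xs"
    using bump_towards[OF assms(1) top_cols_in[OF k]] assms col_seqs_upper[OF assms(1)] top_cols_nth[OF k]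
    by metis
  hence "p < k" using bump_col_seqs(1)[OF assms(1)] by blast
  hence p: "p < k" "0 < k" by auto
  \<comment> \<open>the first column of \<open>xs\<close> is not among the last \<open>k\<close> ones, so it meets the last \<open>k\<close> rows in zeros only\<close>
  have "xs ! 0 \<noteq> n - k"
  proof
    assume *: "xs ! 0 = n - k"
    have "xs ! q = n - k + q" if "q < k" for q
      using col_seqs_gap[OF assms(1), of 0 q] col_seqs_upper[OF assms(1) that] * that by simp
    hence "xs = top_cols n k" using k len by (intro nth_equalityI) (auto simp: top_cols_def)
    thus False using assms by simp
  qed
  hence less: "xs ! 0 < n - k" using col_seqs_upper[OF assms(1), of 0] p by simp
  have "(\<Prod>p = 0..<k. 1\<^sub>m n $$ (n - k + q p, xs ! p)) = (0::real)" if "q permutes {0..<k}" for q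
  proof (rule prod_zero)
    have "q 0 < k" using that permutes_in_image[of q "{0..<k}" 0] p by simp
    thus "\<exists>p\<in>{0..<k}. 1\<^sub>m n $$ (n - k + q p, xs ! p) = (0::real)"
      using p less k by (intro bexI[of _ 0]) auto
  qed simp
  thus ?thesis unfolding minor_expand by (intro sum.neutral) simp
qed

text \<open>
  Conjugation by \<open>diag(1, s, s^2, ...)\<close> acts on the minors through the grading.
\<close>

lemma minor_scale:
  assumes xs: "xs \<in> col_seqs n k" and s: "s > 0" and K: "K \<in> carrier_mat n n"
  shows "minor n k (mat n n (\<lambda>(i, j). s ^ i * inverse s ^ j * K $$ (i, j))) xs = s ^ codepth n xs * minor n k K xs"
proof -
  have k: "k \<le> n" and len: "length xs = k" using col_seqs_length_le xs by (auto simp: col_seqs_def)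
  let ?M = "mat n n (\<lambda>(i, j). s ^ i * inverse s ^ j * K $$ (i, j))"
  have P: "(\<Prod>p = 0..<k. ?M $$ (n - k + q p, xs ! p)) =
      s ^ codepth n xs * (\<Prod>p = 0..<k. K $$ (n - k + q p, xs ! p))" if q: "q permutes {0..<k}" for q
  proof -
    have "n - k + q p < n" if "p < k" for p
    proof -
      have "q p < k" using q that permutes_in_image[of q "{0..<k}" p] by simp
      thus ?thesis using k by linarith
    qed
    hence "(\<Prod>p = 0..<k. ?M $$ (n - k + q p, xs ! p)) =
        (\<Prod>p = 0..<k. s ^ (n - k + q p) * inverse s ^ (xs ! p) * K $$ (n - k + q p, xs ! p))"
      using col_seqs_less[OF xs] by (intro prod.cong) (auto simp del: add_diff_assoc2)
    also have "\<dots> = (\<Prod>p = 0..<k. s ^ (n - k + q p)) * (\<Prod>p = 0..<k. inverse s ^ (xs ! p)) *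
        (\<Prod>p = 0..<k. K $$ (n - k + q p, xs ! p))"
      by (simp add: prod.distrib)
    also have "(\<Prod>p = 0..<k. s ^ (n - k + q p)) = (\<Prod>p = 0..<k. s ^ (n - k + p))"
      using prod.permute[OF q, of "\<lambda>p. s ^ (n - k + p)"] by (simp add: o_def)
    also have "\<dots> = s ^ sum_list (top_cols n k)"
      using k by (simp add: power_sum[symmetric] sum_list_sum_nth top_cols_def)
    also have "(\<Prod>p = 0..<k. inverse s ^ (xs ! p)) = inverse s ^ sum_list xs"
      using len by (simp add: power_sum[symmetric] sum_list_sum_nth)
    also have "s ^ sum_list (top_cols n k) * inverse s ^ sum_list xs = s ^ codepth n xs"
      using col_seqs_sum_le[OF xs] s len by (simp add: codepth_def power_diff power_inverse field_simps)
    finally show ?thesis .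
  qed
  show ?thesis unfolding minor_expand sum_distrib_left
    by (intro sum.cong refl) (simp add: P)
qed

section \<open>The linear system for the minors\<close>

definition chain_system ::
  "nat \<Rightarrow> nat \<Rightarrow> real set \<Rightarrow> (nat \<Rightarrow> real \<Rightarrow> real) \<Rightarrow> (nat list \<Rightarrow> real \<Rightarrow> real) \<Rightarrow> bool" where
  "chain_system n k J c g \<longleftrightarrow> (\<forall>xs\<in>col_seqs n k. \<forall>t\<in>J.
     (g xs has_real_derivative raise n (\<lambda>j. c j t) (\<lambda>ys. g ys t) xs) (at t within J))"

lemma chain_systemD:
  assumes "chain_system n k J c g" "xs \<in> col_seqs n k" "t \<in> J"
  shows "(g xs has_real_derivative raise n (\<lambda>j. c j t) (\<lambda>ys. g ys t) xs) (at t within J)"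
  using assms by (auto simp: chain_system_def)

lemma chain_system_subset:
  assumes "chain_system n k J c g" "J' \<subseteq> J"
  shows "chain_system n k J' c g"
  using assms unfolding chain_system_def by (meson DERIV_subset subsetD)

lemma chain_system_continuous:
  assumes "chain_system n k J c g" "xs \<in> col_seqs n k"
  shows "continuous_on J (g xs)"
  using assms by (intro DERIV_continuous_on) (rule chain_systemD)

text \<open>
  By induction on the codepth, the derivative of \<open>g xs\<close> is a non-negative combination of functions
  already known to be positive to the right of \<open>b\<close>, so \<open>g xs\<close> is non-decreasing there.
\<close>

lemma chain_system_pos_right:
  assumes g: "chain_system n k J c g" and J: "is_interval J" and bt: "b \<in> J" "t \<in> J" "b \<le> t"
    and c: "\<And>j t. Suc j < n \<Longrightarrow> t \<in> J \<Longrightarrow> 0 \<le> c j t"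
    and pos: "\<And>ys. ys \<in> col_seqs n k \<Longrightarrow> 0 < g ys b" and xs: "xs \<in> col_seqs n k"
  shows "0 < g xs t"
  using xs bt(2,3)
proof (induction "codepth n xs" arbitrary: xs t rule: less_induct)
  case less
  have sub: "{b..t} \<subseteq> J" using J bt(1) less.prems(2) unfolding is_interval_1 by (meson atLeastAtMost_iff subsetI)
  have "g xs b \<le> g xs t"
  proof (rule DERIV_nonneg_imp_increasing_open[OF less.prems(3)])
    fix x assume x: "b < x" "x < t"
    have "(g xs has_real_derivative raise n (\<lambda>j. c j x) (\<lambda>ys. g ys x) xs) (at x within {b..t})"
      by (rule chain_systemD[OF chain_system_subset[OF g sub] less.prems(1)]) (use x in simp)
    hence "DERIV (g xs) x :> raise n (\<lambda>j. c j x) (\<lambda>ys. g ys x) xs"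
      by (simp only: at_within_Icc_at[OF x])
    moreover have "0 \<le> raise n (\<lambda>j. c j x) (\<lambda>ys. g ys x) xs"
      unfolding raise_def
    proof (intro sum_nonneg mult_nonneg_nonneg)
      fix p assume p: "p \<in> bumps n xs"
      have xJ: "x \<in> J" using sub x by auto
      show "0 \<le> c (xs ! p) x" using c[OF _ xJ] bump_col_seqs(3)[OF less.prems(1) p] by simp
      show "0 \<le> g (bump xs p) x"
        by (rule less_imp_le, rule less.hyps)
          (use codepth_bump[OF less.prems(1) p] bump_col_seqs(2)[OF less.prems(1) p] xJ x bt(1) in auto)
    qed
    ultimately show "\<exists>y. DERIV (g xs) x :> y \<and> 0 \<le> y" by blast
  next
    show "continuous_on {b..t} (g xs)"
      by (rule chain_system_continuous[OF chain_system_subset[OF g sub] less.prems(1)])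
  qed
  thus ?case using pos[OF less.prems(1)] by simp
qed

text \<open>
  Time reversal changes the sign of every derivative. As raising changes the codepth by one, the signs
  \<open>(-1) ^ codepth\<close> undo this.
\<close>

lemma chain_system_reflect:
  assumes g: "chain_system n k J c g"
  shows "chain_system n k (uminus ` J) (\<lambda>j t. c j (- t)) (\<lambda>xs t. (-1) ^ codepth n xs * g xs (- t))"
  unfolding chain_system_def
proof (intro ballI)
  fix xs t assume xs: "xs \<in> col_seqs n k" and t: "t \<in> uminus ` J"
  have "(g xs has_real_derivative raise n (\<lambda>j. c j (- t)) (\<lambda>ys. g ys (- t)) xs) (at (- t) within J)"
    using chain_systemD[OF g xs] t by auto
  moreover have "((\<lambda>s. g xs (- s)) has_real_derivative - d) (at t within uminus ` J)"
    if "(g xs has_real_derivative d) (at (- t) within J)" for d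
  proof -
    have "(uminus has_real_derivative - 1) (at t within uminus ` J)"
      by (auto intro!: derivative_eq_intros)
    moreover have "uminus ` uminus ` J = J" by (simp add: image_image)
    ultimately show ?thesis
      using DERIV_image_chain[of "g xs" _ uminus t "uminus ` J" "-1"] that by (simp add: o_def)
  qed
  ultimately have *: "((\<lambda>s. g xs (- s)) has_real_derivative - raise n (\<lambda>j. c j (- t)) (\<lambda>ys. g ys (- t)) xs)
      (at t within uminus ` J)" by blast
  have "raise n (\<lambda>j. c j (- t)) (\<lambda>ys. (-1) ^ codepth n ys * g ys (- t)) xs =
      (-1) ^ codepth n xs * - raise n (\<lambda>j. c j (- t)) (\<lambda>ys. g ys (- t)) xs"
    unfolding raise_def sum_distrib_left sum_negf[symmetric]
    by (intro sum.cong refl) (simp add: codepth_bump[OF xs])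
  thus "((\<lambda>s. (-1) ^ codepth n xs * g xs (- s)) has_real_derivative
      raise n (\<lambda>j. c j (- t)) (\<lambda>ys. (-1) ^ codepth n ys * g ys (- t)) xs) (at t within uminus ` J)"
    using DERIV_cmult[OF *, of "(-1) ^ codepth n xs"] by simp
qed

lemma chain_system_pos_left:
  assumes g: "chain_system n k J c g" and J: "is_interval J" and at: "a \<in> J" "t \<in> J" "t \<le> a"
    and c: "\<And>j t. Suc j < n \<Longrightarrow> t \<in> J \<Longrightarrow> 0 \<le> c j t"
    and pos: "\<And>ys. ys \<in> col_seqs n k \<Longrightarrow> 0 < (-1) ^ codepth n ys * g ys a" and xs: "xs \<in> col_seqs n k"
  shows "0 < (-1) ^ codepth n xs * g xs t"
proof -
  have "0 < (-1) ^ codepth n xs * g xs (- (- t))"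
  proof (rule chain_system_pos_right[OF chain_system_reflect[OF g], of "- a"])
    show "is_interval (uminus ` J)" using J by simp
    show "0 \<le> c j (- u)" if "Suc j < n" "u \<in> uminus ` J" for j u using c[OF that(1)] that(2) by auto
    show "0 < (-1) ^ codepth n ys * g ys (- (- a))" if "ys \<in> col_seqs n k" for ys using pos[OF that] by simp
  qed (use at xs in auto)
  thus ?thesis by simp
qed

lemma uniform_limit_sum:
  fixes f :: "'i \<Rightarrow> 'a \<Rightarrow> 'b \<Rightarrow> 'c :: real_normed_vector"
  assumes "\<And>i. i \<in> I \<Longrightarrow> uniform_limit X (f i) (l i) F"
  shows "uniform_limit X (\<lambda>d x. \<Sum>i\<in>I. f i d x) (\<lambda>x. \<Sum>i\<in>I. l i x) F"
  using assms
  by (induction I rule: infinite_finite_induct) (auto intro!: uniform_limit_intros)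

text \<open>
  Continuous dependence on coefficients and initial values. The system is triangular, so no Gronwall
  estimate is needed: by induction on the codepth the derivatives converge uniformly, hence so do the
  functions, as they converge at \<open>t0\<close>. The second claim is the convergence of the derivatives.
\<close>

lemma chain_system_uniform_limit:
  assumes ev: "\<forall>\<^sub>F d in F. chain_system n k {a..b} (c d) (g d)"
    and g0: "chain_system n k {a..b} c0 g0" and t0: "t0 \<in> {a..b}"
    and c: "\<And>j. Suc j < n \<Longrightarrow> uniform_limit {a..b} (\<lambda>d. c d j) (c0 j) F"
    and c0: "\<And>j. Suc j < n \<Longrightarrow> continuous_on {a..b} (c0 j)"
    and init: "\<And>ys. ys \<in> col_seqs n k \<Longrightarrow> ((\<lambda>d. g d ys t0) \<longlongrightarrow> g0 ys t0) F"
    and xs: "xs \<in> col_seqs n k"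
  shows "uniform_limit {a..b} (\<lambda>d. g d xs) (g0 xs) F"
    and "uniform_limit {a..b} (\<lambda>d t. raise n (\<lambda>j. c d j t) (\<lambda>ys. g d ys t) xs)
      (\<lambda>t. raise n (\<lambda>j. c0 j t) (\<lambda>ys. g0 ys t) xs) F"
proof -
  have step: "uniform_limit {a..b} (\<lambda>d t. raise n (\<lambda>j. c d j t) (\<lambda>ys. g d ys t) xs)
      (\<lambda>t. raise n (\<lambda>j. c0 j t) (\<lambda>ys. g0 ys t) xs) F"
    if xs: "xs \<in> col_seqs n k" and
      IH: "\<And>p. p \<in> bumps n xs \<Longrightarrow> uniform_limit {a..b} (\<lambda>d. g d (bump xs p)) (g0 (bump xs p)) F" for xs
    unfolding raise_def
  proof (intro uniform_limit_sum uniform_lim_mult)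
    fix p assume p: "p \<in> bumps n xs"
    note b = bump_col_seqs[OF xs p]
    show "uniform_limit {a..b} (\<lambda>d. c d (xs ! p)) (c0 (xs ! p)) F" using c b by simp
    show "uniform_limit {a..b} (\<lambda>d. g d (bump xs p)) (g0 (bump xs p)) F" by (rule IH[OF p])
    show "bounded (c0 (xs ! p) ` {a..b})"
      using compact_continuous_image[OF c0[OF b(3)]] compact_imp_bounded by auto
    show "bounded (g0 (bump xs p) ` {a..b})"
      using compact_continuous_image[OF chain_system_continuous[OF g0 b(2)]] compact_imp_bounded by auto
  qed
  have main: "uniform_limit {a..b} (\<lambda>d. g d xs) (g0 xs) F" if "xs \<in> col_seqs n k" for xs
    using that
  proof (induction "codepth n xs" arbitrary: xs rule: less_induct)
    case less
    define D where "D d t = raise n (\<lambda>j. c d j t) (\<lambda>ys. g d ys t) xs" for d t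
    define D0 where "D0 t = raise n (\<lambda>j. c0 j t) (\<lambda>ys. g0 ys t) xs" for t
    have D: "uniform_limit {a..b} D D0 F" unfolding D_def D0_def
      using step[OF less.prems] less.hyps codepth_bump[OF less.prems] bump_col_seqs(2)[OF less.prems] by simp
    show ?case unfolding uniform_limit_iff
    proof (intro allI impI)
      fix e :: real assume e: "e > 0"
      \<comment> \<open>the term \<open>1\<close> only guards against division by zero when \<open>a = b\<close>\<close>
      define e1 where "e1 = e / (2 * (b - a + 1))"
      have ab: "a \<le> b" using t0 by simp
      hence e1: "e1 > 0" "e1 * (b - a) < e / 2" using e by (auto simp: e1_def field_simps)
      have "\<forall>\<^sub>F d in F. \<forall>t\<in>{a..b}. dist (D d t) (D0 t) < e1"
        using D e1(1) unfolding uniform_limit_iff by blast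
      moreover have "\<forall>\<^sub>F d in F. dist (g d xs t0) (g0 xs t0) < e / 2"
        using init[OF less.prems] e by (intro tendstoD) auto
      ultimately show "\<forall>\<^sub>F d in F. \<forall>t\<in>{a..b}. dist (g d xs t) (g0 xs t) < e"
        using ev
      proof eventually_elim
        case (elim d)
        show ?case
        proof
          fix t assume t: "t \<in> {a..b}"
          have "norm ((g d xs t - g0 xs t) - (g d xs t0 - g0 xs t0)) \<le> e1 * norm (t - t0)"
          proof (rule field_differentiable_bound[where S = "{a..b}" and f = "\<lambda>t. g d xs t - g0 xs t"
                and f' = "\<lambda>t. D d t - D0 t"])
            fix z assume z: "z \<in> {a..b}"
            show "((\<lambda>t. g d xs t - g0 xs t) has_field_derivative D d z - D0 z) (at z within {a..b})"
              unfolding D_def D0_def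
              by (intro DERIV_diff chain_systemD[OF elim(3)] chain_systemD[OF g0] z less.prems)
            show "norm (D d z - D0 z) \<le> e1" using elim(1) z by (auto simp: dist_norm intro: less_imp_le)
          qed (use t t0 in auto)
          also have "\<dots> \<le> e1 * (b - a)" using t t0 e1 by (intro mult_left_mono) auto
          finally show "dist (g d xs t) (g0 xs t) < e"
            using e1(2) elim(2) by (auto simp: dist_real_def abs_if split: if_splits)
        qed
      qed
    qed
  qed
  show "uniform_limit {a..b} (\<lambda>d. g d xs) (g0 xs) F" by (rule main[OF xs])
  show "uniform_limit {a..b} (\<lambda>d t. raise n (\<lambda>j. c d j t) (\<lambda>ys. g d ys t) xs)
      (\<lambda>t. raise n (\<lambda>j. c0 j t) (\<lambda>ys. g0 ys t) xs) F"
    using step[OF xs] main bump_col_seqs(2)[OF xs] by blast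
qed

section \<open>Stability of simple roots\<close>

lemma bounded_away_from_zero:
  fixes f :: "real \<Rightarrow> real"
  assumes "compact K" "continuous_on K f" "\<And>t. t \<in> K \<Longrightarrow> f t \<noteq> 0"
  shows "\<exists>m>0. \<forall>t\<in>K. m \<le> \<bar>f t\<bar>"
proof (cases "K = {}")
  case False
  obtain x where "x \<in> K" "\<forall>t\<in>K. \<bar>f x\<bar> \<le> \<bar>f t\<bar>"
    using continuous_attains_inf[OF assms(1) False, of "\<lambda>t. \<bar>f t\<bar>"] assms(2)
    by (auto intro: continuous_intros)
  thus ?thesis using assms(3) by (intro exI[of _ "\<bar>f x\<bar>"]) auto
qed (auto intro: exI[of _ 1])

lemma mvt_within:
  fixes f :: "real \<Rightarrow> real"
  assumes "x < y" "{x..y} \<subseteq> S" "\<And>t. t \<in> S \<Longrightarrow> (f has_real_derivative f' t) (at t within S)"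
  obtains z where "x < z" "z < y" "f y - f x = (y - x) * f' z"
proof -
  have "(f has_real_derivative f' t) (at t within {x..y})" if "x \<le> t" "t \<le> y" for t
    using assms(2,3) that by (intro DERIV_subset[OF assms(3)]) auto
  hence "\<And>t. x \<le> t \<Longrightarrow> t \<le> y \<Longrightarrow> (f has_derivative (*) (f' t)) (at t within {x..y})"
    by (simp add: has_field_derivative_def)
  from mvt_simple[OF assms(1) this] show thesis using that by (auto simp: mult.commute)
qed

lemma continuous_nonzero_same_sign:
  fixes f :: "real \<Rightarrow> real"
  assumes "continuous_on {a..b} f" "\<And>t. t \<in> {a..b} \<Longrightarrow> f t \<noteq> 0" "x \<in> {a..b}" "y \<in> {a..b}"
  shows "f x * f y > 0"
proof (rule ccontr)
  assume neg: "\<not> f x * f y > 0"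
  have "connected (f ` {a..b})" using assms(1) by (intro connected_continuous_image) auto
  hence "is_interval (f ` {a..b})" by (simp add: is_interval_connected_1)
  moreover have "f x \<in> f ` {a..b}" "f y \<in> f ` {a..b}" using assms by auto
  moreover have "f x \<le> 0 \<and> 0 \<le> f y \<or> f y \<le> 0 \<and> 0 \<le> f x"
    using neg by (auto simp: zero_less_mult_iff not_less)
  ultimately have "0 \<in> f ` {a..b}" by (auto simp: is_interval_1)
  thus False using assms(2) by auto
qed

lemma sign_change_root:
  fixes f :: "real \<Rightarrow> real"
  assumes "a \<le> b" "continuous_on {a..b} f" "f a * f b < 0"
  obtains x where "a < x" "x < b" "f x = 0"
proof -
  have "\<exists>x\<in>{a..b}. f x = 0"
    using continuous_nonzero_same_sign[OF assms(2), of a b] assms(1,3) by fastforce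
  then obtain x where "x \<in> {a..b}" "f x = 0" by blast
  moreover have "f a \<noteq> 0" "f b \<noteq> 0" using assms(3) by auto
  ultimately have "a < x" "x < b" by (auto simp: order.order_iff_strict)
  thus thesis using that \<open>f x = 0\<close> by blast
qed

text \<open>
  Around each root of \<open>f\<close> choose an interval on which \<open>f'\<close> does not vanish, the intervals being disjoint.
  Off these intervals \<open>f\<close> is bounded away from \<open>0\<close>, so a function close to \<open>f\<close> has no root there. On each
  of them \<open>f\<close> changes sign, so a function that is \<open>C^1\<close>-close to \<open>f\<close> has a root by the intermediate value
  theorem and at most one by Rolle's theorem.
\<close>

lemma simple_roots_stable:
  fixes f f' :: "real \<Rightarrow> real" and h h' :: "'a \<Rightarrow> real \<Rightarrow> real"
  assumes f: "\<And>t. t \<in> {a..b} \<Longrightarrow> (f has_real_derivative f' t) (at t within {a..b})"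
    and f': "continuous_on {a..b} f'" and ends: "f a \<noteq> 0" "f b \<noteq> 0"
    and fin: "finite (roots_on {a..b} f)"
    and simple: "\<And>t. t \<in> roots_on {a..b} f \<Longrightarrow> f' t \<noteq> 0" and eta: "0 < \<eta>"
    and h: "\<forall>\<^sub>F d in F. \<forall>t\<in>{a..b}. (h d has_real_derivative h' d t) (at t within {a..b})"
    and lim: "uniform_limit {a..b} h f F" "uniform_limit {a..b} h' f' F"
  shows "\<forall>\<^sub>F d in F. finite (roots_on {a..b} (h d)) \<and>
    card (roots_on {a..b} (h d)) = card (roots_on {a..b} f) \<and>
    (\<forall>t\<in>roots_on {a..b} (h d). h' d t \<noteq> 0) \<and>
    (\<forall>p\<in>roots_on {a..b} f. \<exists>q\<in>roots_on {a..b} (h d). \<bar>q - p\<bar> < \<eta>)"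
proof -
  define Z where "Z = roots_on {a..b} f"
  have ZI: "a < p" "p < b" "f p = 0" "f' p \<noteq> 0" if "p \<in> Z" for p
    using that ends simple[of p] by (auto simp: Z_def roots_on_def order.order_iff_strict)
  have contf: "continuous_on {a..b} f"
    by (rule DERIV_continuous_on) (rule f)
  have "\<forall>\<^sub>F r in at_right 0. \<forall>p\<in>Z. r < \<eta> \<and> a < p - r \<and> p + r < b \<and> (\<forall>q\<in>Z. q \<noteq> p \<longrightarrow> 2 * r < \<bar>p - q\<bar>)
      \<and> (\<forall>t\<in>{p - r..p + r}. f' t \<noteq> 0)"
  proof (intro eventually_ball_finite ballI eventually_conj)
    show "finite Z" using fin by (simp add: Z_def)
    show "finite Z" by fact
    have less: "\<forall>\<^sub>F r in at_right 0. r < d" if "0 < d" for d :: real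
      using that by (intro eventually_at_rightI[of 0 d]) auto
    fix p assume p: "p \<in> Z"
    show "\<forall>\<^sub>F r in at_right 0. r < \<eta>" by (rule less[OF eta])
    show "\<forall>\<^sub>F r in at_right 0. a < p - r"
      using less[of "p - a"] ZI[OF p] by (auto elim: eventually_mono)
    show "\<forall>\<^sub>F r in at_right 0. p + r < b"
      using less[of "b - p"] ZI[OF p] by (auto elim: eventually_mono)
    show "\<forall>\<^sub>F r in at_right 0. q \<noteq> p \<longrightarrow> 2 * r < \<bar>p - q\<bar>" if "q \<in> Z" for q
      using less[of "\<bar>p - q\<bar> / 2"] by (cases "p = q") (auto elim: eventually_mono)
    have "isCont f' p" using f' ZI[OF p] by (intro continuous_on_interior) auto
    then obtain d where d: "d > 0" "\<And>t. dist t p < d \<Longrightarrow> dist (f' t) (f' p) < \<bar>f' p\<bar>"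
      using ZI(4)[OF p] unfolding continuous_at_eps_delta by (metis dist_commute zero_less_abs_iff)
    have "\<forall>t\<in>{p - r..p + r}. f' t \<noteq> 0" if "r < d" for r
    proof
      fix t assume "t \<in> {p - r..p + r}"
      hence "dist (f' t) (f' p) < \<bar>f' p\<bar>" using that by (intro d) (auto simp: dist_real_def)
      thus "f' t \<noteq> 0" by (auto simp: dist_real_def)
    qed
    thus "\<forall>\<^sub>F r in at_right 0. \<forall>t\<in>{p - r..p + r}. f' t \<noteq> 0"
      using less[OF d(1)] by (auto elim!: eventually_mono)
  qed
  moreover have "\<forall>\<^sub>F r in at_right (0::real). 0 < r" by (simp add: eventually_at_right_less)
  ultimately have "\<forall>\<^sub>F r in at_right (0::real). 0 < r \<and> (\<forall>p\<in>Z. r < \<eta> \<and> a < p - r \<and> p + r < b \<and>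
      (\<forall>q\<in>Z. q \<noteq> p \<longrightarrow> 2 * r < \<bar>p - q\<bar>) \<and> (\<forall>t\<in>{p - r..p + r}. f' t \<noteq> 0))"
    by eventually_elim blast
  from eventually_happens'[OF trivial_limit_at_right_real this]
  obtain r where r: "0 < r" and all: "\<forall>p\<in>Z. r < \<eta> \<and> a < p - r \<and> p + r < b \<and>
      (\<forall>q\<in>Z. q \<noteq> p \<longrightarrow> 2 * r < \<bar>p - q\<bar>) \<and> (\<forall>t\<in>{p - r..p + r}. f' t \<noteq> 0)" by (elim exE conjE)
  have rZ: "r < \<eta> \<and> a < p - r \<and> p + r < b" if "p \<in> Z" for p using bspec[OF all that] by simp
  have sep: "2 * r < \<bar>p - q\<bar>" if "p \<in> Z" "q \<in> Z" "q \<noteq> p" for p q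
    using bspec[OF all that(1)] that(2,3) by simp
  have f'nz: "f' t \<noteq> 0" if "p \<in> Z" "t \<in> {p - r..p + r}" for p t
    using bspec[OF all that(1)] that(2) by simp
  define K where "K = {a..b} - (\<Union>p\<in>Z. {p - r<..<p + r})"
  define K' where "K' = (\<Union>p\<in>Z. {p - r..p + r})"
  have sub: "{p - r..p + r} \<subseteq> {a..b}" if "p \<in> Z" for p using rZ[OF that] by auto
  have "compact K" unfolding K_def by (intro compact_diff open_UN) auto
  moreover have "continuous_on K f" using contf by (rule continuous_on_subset) (auto simp: K_def)
  moreover have "f t \<noteq> 0" if "t \<in> K" for t
  proof
    assume "f t = 0"
    hence "t \<in> Z" "t \<in> {t - r<..<t + r}" using that r by (auto simp: K_def Z_def roots_on_def)
    thus False using that unfolding K_def by blast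
  qed
  ultimately have "\<exists>m>0. \<forall>t\<in>K. m \<le> \<bar>f t\<bar>" by (rule bounded_away_from_zero)
  then obtain m where m: "0 < m" "\<And>t. t \<in> K \<Longrightarrow> m \<le> \<bar>f t\<bar>" by blast
  have "compact K'" unfolding K'_def using fin by (intro compact_UN) (auto simp: Z_def)
  moreover have "continuous_on K' f'" using f' by (rule continuous_on_subset) (use sub in \<open>unfold K'_def, blast\<close>)
  moreover have "f' t \<noteq> 0" if "t \<in> K'" for t using that f'nz unfolding K'_def by blast
  ultimately have "\<exists>m>0. \<forall>t\<in>K'. m \<le> \<bar>f' t\<bar>" by (rule bounded_away_from_zero)
  then obtain m' where m': "0 < m'" "\<And>t. t \<in> K' \<Longrightarrow> m' \<le> \<bar>f' t\<bar>" by blast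
  have "\<forall>\<^sub>F d in F. \<forall>t\<in>{a..b}. dist (h d t) (f t) < m"
    using lim(1) m(1) unfolding uniform_limit_iff by blast
  moreover have "\<forall>\<^sub>F d in F. \<forall>t\<in>{a..b}. dist (h' d t) (f' t) < m'"
    using lim(2) m'(1) unfolding uniform_limit_iff by blast
  ultimately show ?thesis using h
  proof eventually_elim
    case (elim d)
    have conth: "continuous_on {a..b} (h d)"
      by (rule DERIV_continuous_on) (use elim(3) in blast)
    have outside: "h d t \<noteq> 0" if "t \<in> K" for t
    proof -
      have "dist (h d t) (f t) < m" using elim(1) that unfolding K_def by blast
      thus ?thesis using m(2)[OF that] by (auto simp: dist_real_def)
    qed
    have inside: "h' d t \<noteq> 0" if "p \<in> Z" "t \<in> {p - r..p + r}" for p t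
    proof -
      have "dist (h' d t) (f' t) < m'" using elim(2) sub[OF that(1)] that(2) by blast
      moreover have "t \<in> K'" using that unfolding K'_def by blast
      ultimately show ?thesis using m'(2)[of t] by (auto simp: dist_real_def)
    qed
    have ex: "\<exists>x. x \<in> {p - r<..<p + r} \<and> h d x = 0" if p: "p \<in> Z" for p
    proof -
      obtain x where x: "p - r < x" "x < p" "f p - f (p - r) = (p - (p - r)) * f' x"
        by (rule mvt_within[of "p - r" p "{a..b}" f f']) (use f r rZ[OF p] in auto)
      obtain y where y: "p < y" "y < p + r" "f (p + r) - f p = (p + r - p) * f' y"
        by (rule mvt_within[of p "p + r" "{a..b}" f f']) (use f r rZ[OF p] in auto)
      have "f' x * f' y > 0"
        using x y sub[OF p] by (intro continuous_nonzero_same_sign[of "p - r" "p + r"] f'nz[OF p]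
            continuous_on_subset[OF f']) auto
      moreover have "f (p - r) = - (r * f' x)" "f (p + r) = r * f' y" using x(3) y(3) ZI[OF p] by simp_all
      hence "f (p - r) * f (p + r) = - (r * r * (f' x * f' y))" by simp
      ultimately have fneg: "f (p - r) * f (p + r) < 0" using r by simp
      have not_between: "\<not> (q - r < x \<and> x < q + r)" if "x = p - r \<or> x = p + r" "q \<in> Z" for q x
        using sep[OF p that(2)] that(1) r by (cases "q = p") (auto simp: abs_if split: if_splits)
      have K: "p - r \<in> K" "p + r \<in> K"
        using rZ[OF p] r not_between[of "p - r"] not_between[of "p + r"] unfolding K_def by simp_all
      have "dist (h d (p - r)) (f (p - r)) < m" "dist (h d (p + r)) (f (p + r)) < m"
        using elim(1) rZ[OF p] r by simp_all
      hence close: "\<bar>h d (p - r) - f (p - r)\<bar> < \<bar>f (p - r)\<bar>" "\<bar>h d (p + r) - f (p + r)\<bar> < \<bar>f (p + r)\<bar>"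
        using m(2)[OF K(1)] m(2)[OF K(2)] by (simp_all add: dist_real_def)
      have "h d (p - r) * h d (p + r) < 0"
      proof -
        have "sgn y = sgn x" if "\<bar>y - x\<bar> < \<bar>x\<bar>" for x y :: real
          using that by (auto simp: sgn_if abs_if split: if_splits)
        hence "sgn (h d (p - r) * h d (p + r)) = sgn (f (p - r) * f (p + r))"
          unfolding sgn_mult using close by simp
        thus ?thesis using fneg by (metis sgn_less)
      qed
      moreover have "continuous_on {p - r..p + r} (h d)" by (rule continuous_on_subset[OF conth sub[OF p]])
      moreover have "p - r \<le> p + r" using r by simp
      ultimately obtain x where "p - r < x" "x < p + r" "h d x = 0" using sign_change_root by blast
      thus ?thesis by auto
    qed
    then obtain \<rho> where \<rho>: "\<And>p. p \<in> Z \<Longrightarrow> \<rho> p \<in> {p - r<..<p + r} \<and> h d (\<rho> p) = 0" by metis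
    have unique: "x = y" if p: "p \<in> Z" and xy: "x \<in> {p - r..p + r}" "y \<in> {p - r..p + r}" "h d x = 0" "h d y = 0" for p x y
    proof (rule ccontr)
      assume "x \<noteq> y"
      define u v where "u = min x y" and "v = max x y"
      have uv: "u < v" "u \<in> {p - r..p + r}" "v \<in> {p - r..p + r}" "h d u = 0" "h d v = 0"
        using xy \<open>x \<noteq> y\<close> by (auto simp: u_def v_def min_def max_def)
      obtain z where z: "u < z" "z < v" "h d v - h d u = (v - u) * h' d z"
        by (rule mvt_within[of u v "{a..b}" "h d" "h' d"]) (use uv sub[OF p] elim(3) in auto)
      have "z \<in> {p - r..p + r}" using z uv by auto
      thus False using inside[OF p, of z] z uv by simp
    qed
    have roots: "roots_on {a..b} (h d) = \<rho> ` Z"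
    proof
      show "\<rho> ` Z \<subseteq> roots_on {a..b} (h d)"
      proof (rule image_subsetI)
        fix p assume p: "p \<in> Z"
        have "\<rho> p \<in> {p - r..p + r}" using \<rho>[OF p] by simp
        hence "\<rho> p \<in> {a..b}" using sub[OF p] by blast
        thus "\<rho> p \<in> roots_on {a..b} (h d)" using \<rho>[OF p] unfolding roots_on_def by blast
      qed
      show "roots_on {a..b} (h d) \<subseteq> \<rho> ` Z"
      proof
        fix x assume "x \<in> roots_on {a..b} (h d)"
        hence x: "x \<in> {a..b}" "h d x = 0" by (auto simp: roots_on_def)
        hence "x \<notin> K" using outside by blast
        then obtain p where p: "p \<in> Z" "x \<in> {p - r<..<p + r}" using x(1) unfolding K_def by blast
        have "x = \<rho> p"
          by (rule unique[OF p(1)]) (use p(2) \<rho>[OF p(1)] x(2) in simp_all)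
        thus "x \<in> \<rho> ` Z" using p by blast
      qed
    qed
    have "inj_on \<rho> Z"
    proof (rule inj_onI, rule ccontr)
      fix p q assume pq: "p \<in> Z" "q \<in> Z" "\<rho> p = \<rho> q" "p \<noteq> q"
      have "2 * r < \<bar>p - q\<bar>" using sep[OF pq(1,2)] pq(4) by simp
      moreover have "\<bar>p - q\<bar> < 2 * r" using \<rho>[OF pq(1)] \<rho>[OF pq(2)] pq(3) by simp arith
      ultimately show False by simp
    qed
    hence "card (\<rho> ` Z) = card Z" by (rule card_image)
    moreover have "\<exists>q\<in>\<rho> ` Z. \<bar>q - p\<bar> < \<eta>" if "p \<in> Z" for p
    proof
      show "\<bar>\<rho> p - p\<bar> < \<eta>" using \<rho>[OF that] rZ[OF that] by simp arith
      show "\<rho> p \<in> \<rho> ` Z" using that by blast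
    qed
    moreover have "h' d t \<noteq> 0" if "t \<in> \<rho> ` Z" for t
    proof -
      obtain p where p: "p \<in> Z" "t = \<rho> p" using \<open>t \<in> \<rho> ` Z\<close> by blast
      show ?thesis by (rule inside[OF p(1)]) (use \<rho>[OF p(1)] p(2) in simp)
    qed
    moreover have "finite (\<rho> ` Z)" using fin by (simp add: Z_def)
    ultimately show ?case unfolding roots Z_def[symmetric] by blast
  qed
qed

section \<open>The polynomial model\<close>

text \<open>
  The component \<open>xs\<close> of \<open>exp(t * raise)\<close> applied to \<open>v\<close>, that is, the solution with initial value \<open>v\<close> of
  the system with constant coefficients \<open>c\<close>.
\<close>

definition chain_poly :: "nat \<Rightarrow> (nat \<Rightarrow> real) \<Rightarrow> (nat list \<Rightarrow> real) \<Rightarrow> nat list \<Rightarrow> real poly" where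
  "chain_poly n c v xs = (\<Sum>m\<le>codepth n xs. monom ((raise n c ^^ m) v xs / fact m) m)"

lemma coeff_chain_poly:
  assumes "xs \<in> col_seqs n k"
  shows "coeff (chain_poly n c v xs) m = (raise n c ^^ m) v xs / fact m"
proof -
  have "coeff (chain_poly n c v xs) m =
      (if m \<le> codepth n xs then (raise n c ^^ m) v xs / fact m else 0)"
    by (simp add: chain_poly_def coeff_sum)
  moreover have "(raise n c ^^ m) v xs = 0" if "\<not> m \<le> codepth n xs"
    using that by (intro raise_power_eq_0[OF assms]) auto
  ultimately show ?thesis by auto
qed

lemma degree_chain_poly: "degree (chain_poly n c v xs) \<le> codepth n xs"
  unfolding chain_poly_def by (intro degree_sum_le order.trans[OF degree_monom_le]) auto

lemma pderiv_chain_poly: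
  assumes "xs \<in> col_seqs n k"
  shows "pderiv (chain_poly n c v xs) =
    (\<Sum>p\<in>bumps n xs. smult (c (xs ! p)) (chain_poly n c v (bump xs p)))"
proof (rule poly_eqI)
  fix m
  have "coeff (pderiv (chain_poly n c v xs)) m = (raise n c ^^ Suc m) v xs / fact m"
    unfolding coeff_pderiv coeff_chain_poly[OF assms] by (simp add: field_simps del: funpow.simps of_nat_Suc)
  also have "\<dots> = (\<Sum>p\<in>bumps n xs. c (xs ! p) * ((raise n c ^^ m) v (bump xs p) / fact m))"
    unfolding raise_power_Suc by (simp add: sum_divide_distrib)
  also have "\<dots> = coeff (\<Sum>p\<in>bumps n xs. smult (c (xs ! p)) (chain_poly n c v (bump xs p))) m"
    unfolding coeff_sum coeff_smult
    by (intro sum.cong refl) (simp add: coeff_chain_poly[OF bump_col_seqs(2)[OF assms]])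
  finally show "coeff (pderiv (chain_poly n c v xs)) m =
    coeff (\<Sum>p\<in>bumps n xs. smult (c (xs ! p)) (chain_poly n c v (bump xs p))) m" .
qed

lemma chain_system_chain_poly:
  "chain_system n k J (\<lambda>j t. c j) (\<lambda>xs. poly (chain_poly n c v xs))"
  unfolding chain_system_def
proof (intro ballI)
  fix xs t assume xs: "xs \<in> col_seqs n k"
  have "DERIV (poly (chain_poly n c v xs)) t :> poly (pderiv (chain_poly n c v xs)) t"
    by (rule poly_DERIV)
  also have "poly (pderiv (chain_poly n c v xs)) t = raise n c (\<lambda>ys. poly (chain_poly n c v ys) t) xs"
    unfolding pderiv_chain_poly[OF xs] raise_def by (simp add: poly_sum)
  finally show "(poly (chain_poly n c v xs) has_real_derivative
      raise n c (\<lambda>ys. poly (chain_poly n c v ys) t) xs) (at t within J)"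
    by (rule has_field_derivative_at_within)
qed

lemma poly_chain_poly_0:
  assumes "xs \<in> col_seqs n k"
  shows "poly (chain_poly n c v xs) 0 = v xs"
  by (simp add: poly_0_coeff_0 coeff_chain_poly[OF assms])

lemma raise_power_cong:
  assumes "xs \<in> col_seqs n k" "\<And>ys. ys \<in> col_seqs n k \<Longrightarrow> v ys = w ys"
  shows "(raise n c ^^ m) v xs = (raise n c ^^ m) w xs"
  using assms(1)
proof (induction m arbitrary: xs)
  case (Suc m)
  show ?case unfolding raise_power_Suc
    by (intro sum.cong refl) (simp add: Suc.IH[OF bump_col_seqs(2)[OF Suc.prems]])
qed (use assms(2) in simp)

lemma raise_power_add:
  "(raise n c ^^ m) (\<lambda>ys. v ys + e * w ys) xs = (raise n c ^^ m) v xs + e * (raise n c ^^ m) w xs"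
proof (induction m arbitrary: xs)
  case (Suc m)
  show ?case unfolding raise_power_Suc Suc.IH
    by (simp add: sum_distrib_left algebra_simps sum.distrib)
qed simp

lemma chain_poly_add:
  assumes "xs \<in> col_seqs n k" "\<And>ys. ys \<in> col_seqs n k \<Longrightarrow> u ys = v ys + e * w ys"
  shows "chain_poly n c u xs = chain_poly n c v xs + smult e (chain_poly n c w xs)"
proof (rule poly_eqI)
  fix m
  have "(raise n c ^^ m) u xs = (raise n c ^^ m) (\<lambda>ys. v ys + e * w ys) xs"
    by (rule raise_power_cong[OF assms])
  also have "\<dots> = (raise n c ^^ m) v xs + e * (raise n c ^^ m) w xs" by (rule raise_power_add)
  finally show "coeff (chain_poly n c u xs) m = coeff (chain_poly n c v xs + smult e (chain_poly n c w xs)) m"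
    by (simp add: coeff_chain_poly[OF assms(1)] add_divide_distrib)
qed

lemma poly_sign_near_0:
  fixes p :: "real poly"
  assumes "\<And>i. i < m \<Longrightarrow> coeff p i = 0" "0 < coeff p m"
  shows "\<forall>\<^sub>F t in at_left 0. 0 < (-1) ^ m * poly p t"
proof -
  have "monom 1 m dvd p" using assms(1) by (simp add: monom_1_dvd_iff')
  then obtain q where q: "p = monom 1 m * q" by blast
  have "0 < poly q 0" using assms(2) by (simp add: q coeff_monom_mult poly_0_coeff_0)
  moreover have "isCont (poly q) 0" by simp
  hence "(poly q \<longlongrightarrow> poly q 0) (at_left 0)"
    unfolding isCont_def by (rule tendsto_within_subset) simp
  ultimately have "\<forall>\<^sub>F t in at_left 0. 0 < poly q t" by (simp add: order_tendstoD)
  moreover have "\<forall>\<^sub>F t in at_left (0::real). t < 0" by (simp add: eventually_at_filter)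
  ultimately show ?thesis
  proof eventually_elim
    case (elim t)
    have "(-1) ^ m * poly p t = (- t) ^ m * poly q t"
      by (simp add: q poly_monom power_minus[of t])
    thus ?case using elim by simp
  qed
qed

lemma poly_sign_near_infinity:
  fixes p :: "real poly"
  assumes "degree p \<le> m" "0 < coeff p m"
  shows "\<forall>\<^sub>F t in at_top. 0 < poly p t \<and> 0 < (-1) ^ m * poly p (- t)"
proof -
  have deg: "degree p = m" using assms by (intro antisym le_degree) auto
  have ev: "\<forall>\<^sub>F t in at_top. 0 < poly q t" if "0 < lead_coeff q" for q :: "real poly"
  proof -
    obtain b where b: "\<And>t. t \<ge> b \<Longrightarrow> lead_coeff q \<le> poly q t"
      using poly_pinfty_gt_lc[OF \<open>0 < lead_coeff q\<close>] by blast
    show ?thesis unfolding eventually_at_top_linorder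
      by (intro exI[of _ b] allI impI) (use b that in force)
  qed
  let ?q = "smult ((-1) ^ m) (pcompose p [:0, -1:])"
  have "lead_coeff ?q = (-1) ^ m * (lead_coeff p * (-1) ^ m)"
    using lead_coeff_comp[of "[:0, -1:]" p] deg by (simp add: lead_coeff_smult)
  also have "\<dots> = lead_coeff p" by (simp add: minus_one_power_iff)
  finally have "lead_coeff ?q = lead_coeff p" .
  hence "\<forall>\<^sub>F t in at_top. 0 < poly ?q t" using assms deg by (intro ev) simp
  moreover have "\<forall>\<^sub>F t in at_top. 0 < poly p t" using assms deg by (intro ev) simp
  ultimately show ?thesis by eventually_elim (simp add: poly_pcompose)
qed

lemma codepth_le_bottom:
  assumes "xs \<in> col_seqs n k"
  shows "codepth n xs \<le> k * (n - k)"
proof -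
  have "sum_list [0..<k] \<le> sum_list xs"
    using assms col_seqs_lower[OF assms] by (intro sum_list_mono_nth) (auto simp: col_seqs_def)
  thus ?thesis using codepth_bottom[OF col_seqs_length_le[OF assms]] assms by (auto simp: codepth_def col_seqs_def)
qed

text \<open>
  If \<open>m\<close> is the largest codepth in the support of \<open>v\<close>, then the zero of the polynomial at \<open>0\<close> has order
  \<open>k * (n - k) - m\<close>, with positive lowest coefficient. Therefore its sign to the left of \<open>0\<close> is given by
  the parity of this order, which is that of \<open>k * (n - k) + m\<close>.
\<close>

lemma chain_poly_bottom_sign:
  assumes c: "\<And>j. Suc j < n \<Longrightarrow> 0 < c j"
    and nonneg: "\<And>ys. ys \<in> col_seqs n k \<Longrightarrow> 0 \<le> v ys"
    and S: "S \<in> col_seqs n k" "codepth n S = m" "0 < v S"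
    and zero: "\<And>ys. ys \<in> col_seqs n k \<Longrightarrow> m < codepth n ys \<Longrightarrow> v ys = 0"
  shows "\<forall>\<^sub>F t in at_left 0. 0 < (-1) ^ (k * (n - k) + m) * poly (chain_poly n c v [0..<k]) t"
proof -
  let ?N = "k * (n - k)"
  have k: "k \<le> n" using col_seqs_length_le[OF S(1)] .
  have bot: "[0..<k] \<in> col_seqs n k" using bottom_cols_in[OF k] .
  have cd: "codepth n [0..<k] = ?N" using codepth_bottom[OF k] .
  have m: "m \<le> ?N" using codepth_le_bottom[OF S(1)] S(2) by simp
  have "(raise n c ^^ i) v [0..<k] = 0" if "i < ?N - m" for i
    using that by (intro raise_power_eq_0[OF bot] zero) (auto simp: cd)
  moreover have "0 < (raise n c ^^ (?N - m)) v [0..<k]"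
    using m S col_seqs_lower[OF S(1)] by (intro raise_power_pos[OF bot S(1)] nonneg c) (auto simp: cd)
  ultimately have "\<forall>\<^sub>F t in at_left 0. 0 < (-1) ^ (?N - m) * poly (chain_poly n c v [0..<k]) t"
    by (intro poly_sign_near_0) (auto simp: coeff_chain_poly[OF bot])
  moreover have "(-1::real) ^ (?N - m) = (-1) ^ (?N + m)"
    using m even_diff_nat[of ?N m] unfolding minus_one_power_iff by simp
  ultimately show ?thesis by simp
qed

text \<open>
  Sign changes at given points are an open condition, unlike the roots between them. The signs are
  normalised in such a way that a polynomial with zero of order \<open>N - m\<close> at \<open>0\<close> and positive lowest
  coefficient has the right sign at a point \<open>x m\<close> close to \<open>0\<close>.
\<close>

definition alternates :: "real poly \<Rightarrow> nat \<Rightarrow> nat \<Rightarrow> (nat \<Rightarrow> real) \<Rightarrow> bool" where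
  "alternates p N m x \<longleftrightarrow> (\<forall>i<m. x i < x (Suc i)) \<and> x m < 0 \<and>
     (\<forall>i\<le>m. 0 < (-1) ^ (N + i) * poly p (x i))"

lemma alternates_card_roots:
  assumes "alternates p N m x" "p \<noteq> 0"
  shows "m \<le> card {t. poly p t = 0}"
proof -
  have "\<exists>r. x i < r \<and> r < x (Suc i) \<and> poly p r = 0" if i: "i < m" for i
  proof -
    have lt: "x i < x (Suc i)" using assms i by (auto simp: alternates_def)
    have "0 < ((-1) ^ (N + i) * poly p (x i)) * ((-1) ^ (N + Suc i) * poly p (x (Suc i)))"
    proof (rule mult_pos_pos)
      have "\<forall>i\<le>m. 0 < (-1) ^ (N + i) * poly p (x i)" using assms(1) by (simp add: alternates_def)
      thus "0 < (-1) ^ (N + i) * poly p (x i)" "0 < (-1) ^ (N + Suc i) * poly p (x (Suc i))"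
        using i by (auto simp del: power_Suc add_Suc_right)
    qed
    also have "\<dots> = - (((-1) ^ (N + i)) ^ 2 * (poly p (x i) * poly p (x (Suc i))))"
      by (simp add: power2_eq_square)
    also have "((-1::real) ^ (N + i)) ^ 2 = 1" by (simp add: power_even_eq[symmetric] power_mult[symmetric])
    finally have "poly p (x i) * poly p (x (Suc i)) < 0" by simp
    moreover have "continuous_on {x i..x (Suc i)} (poly p)" by (intro continuous_intros)
    ultimately obtain r where "x i < r" "r < x (Suc i)" "poly p r = 0"
      using sign_change_root[of "x i" "x (Suc i)" "poly p"] lt by auto
    thus ?thesis by blast
  qed
  then obtain r where r: "\<And>i. i < m \<Longrightarrow> x i < r i \<and> r i < x (Suc i) \<and> poly p (r i) = 0" by metis
  have mono: "x i \<le> x j" if "i \<le> j" "j \<le> m" for i j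
    using that
  proof (induction j)
    case (Suc j)
    show ?case
    proof (cases "i = Suc j")
      case False
      hence "x i \<le> x j" using Suc by simp
      also have "x j < x (Suc j)" using assms(1) Suc.prems by (auto simp: alternates_def)
      finally show ?thesis by simp
    qed simp
  qed simp
  have "inj_on r {..<m}"
  proof (rule linorder_inj_onI)
    fix i j :: nat assume ij: "i < j" "i \<in> {..<m}" "j \<in> {..<m}"
    have "r i < x (Suc i)" "x (Suc i) \<le> x j" "x j < r j" using r[of i] r[of j] mono[of "Suc i" j] ij by auto
    thus "r i \<noteq> r j" by simp
  qed auto
  hence "m = card (r ` {..<m})" by (simp add: card_image)
  also have "\<dots> \<le> card {t. poly p t = 0}"
    using r poly_roots_finite[OF assms(2)] by (intro card_mono) auto
  finally show ?thesis .
qed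

text \<open>
  Removing one factor of a multiple root would leave a polynomial with the same roots and of smaller
  degree.
\<close>

lemma poly_max_roots_simple:
  fixes p :: "real poly"
  assumes "p \<noteq> 0" "degree p \<le> card {t. poly p t = 0}" "poly p r = 0"
  shows "poly (pderiv p) r \<noteq> 0"
proof
  assume "poly (pderiv p) r = 0"
  obtain q where q: "p = [:- r, 1:] * q" using assms(3) by (auto simp: poly_eq_0_iff_dvd)
  have "q \<noteq> 0" using assms(1) q by auto
  have "pderiv p = [:- r, 1:] * pderiv q + q * pderiv [:- r, 1:]" by (simp only: q pderiv_mult)
  hence "poly q r = 0" using \<open>poly (pderiv p) r = 0\<close> by (simp add: pderiv_pCons)
  hence "{t. poly p t = 0} = {t. poly q t = 0}" by (auto simp: q)
  hence "card {t. poly p t = 0} \<le> degree q" using card_poly_roots_bound[OF \<open>q \<noteq> 0\<close>] by simp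
  moreover have "degree p = Suc (degree q)" using \<open>q \<noteq> 0\<close> unfolding q by (subst degree_mult_eq) auto
  ultimately show False using assms(2) by simp
qed

text \<open>
  The state for one \<open>k\<close> of the successive splitting of the zero at \<open>0\<close>: the vector \<open>v\<close> of minors is
  non-negative with largest codepth \<open>m\<close> in its support, so that a zero of order \<open>k * (n - k) - m\<close> is left,
  and \<open>m\<close> negative roots are separated by sign changes.
\<close>

definition split_stage ::
  "nat \<Rightarrow> (nat \<Rightarrow> real) \<Rightarrow> nat \<Rightarrow> nat \<Rightarrow> (nat list \<Rightarrow> real) \<Rightarrow> bool" where
  "split_stage n c k m v \<longleftrightarrow> (\<forall>ys\<in>col_seqs n k. 0 \<le> v ys) \<and>
     (\<exists>S\<in>col_seqs n k. codepth n S = m \<and> 0 < v S) \<and>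
     (\<forall>ys\<in>col_seqs n k. m < codepth n ys \<longrightarrow> v ys = 0) \<and>
     (\<exists>x. alternates (chain_poly n c v [0..<k]) (k * (n - k)) m x)"

lemma split_stageI:
  assumes "\<And>ys. ys \<in> col_seqs n k \<Longrightarrow> 0 \<le> v ys"
    and "S \<in> col_seqs n k" "codepth n S = m" "0 < v S"
    and "\<And>ys. ys \<in> col_seqs n k \<Longrightarrow> m < codepth n ys \<Longrightarrow> v ys = 0"
    and "alternates (chain_poly n c v [0..<k]) (k * (n - k)) m x"
  shows "split_stage n c k m v"
  using assms unfolding split_stage_def by blast

lemma eventually_alternation_persists:
  fixes p q :: "real poly"
  assumes "\<And>i. i \<le> m \<Longrightarrow> 0 < (-1) ^ (N + i) * poly p (x i)"
  shows "\<forall>\<^sub>F e in at_right 0. \<forall>i\<le>m. 0 < (-1) ^ (N + i) * poly (p + smult e q) (x i)"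
proof -
  have "\<forall>\<^sub>F e in at_right 0. \<forall>i\<in>{..m}. 0 < (-1) ^ (N + i) * poly (p + smult e q) (x i)"
  proof (intro eventually_ball_finite ballI)
    fix i assume "i \<in> {..m}"
    have "((\<lambda>e. (-1) ^ (N + i) * (poly p (x i) + e * poly q (x i))) \<longlongrightarrow>
        (-1) ^ (N + i) * (poly p (x i) + 0 * poly q (x i))) (at_right 0)"
      by (intro tendsto_intros)
    moreover have "0 < (-1) ^ (N + i) * (poly p (x i) + 0 * poly q (x i))"
      using assms[of i] \<open>i \<in> {..m}\<close> by simp
    ultimately show "\<forall>\<^sub>F e in at_right 0. 0 < (-1) ^ (N + i) * poly (p + smult e q) (x i)"
      using order_tendstoD(1) by fastforce
  qed simp
  thus ?thesis by (simp add: Ball_def)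
qed

text \<open>
  A column operation changes \<open>v\<close> into \<open>v + e * raise n d v\<close>. Raising cannot reach beyond codepth
  \<open>m + 1\<close>, so the order of the zero at \<open>0\<close> drops by at most one. If it drops, then the sign of the
  polynomial just to the left of \<open>0\<close> flips for every small \<open>e > 0\<close>, which supplies the next point of the
  alternating sequence.
\<close>

lemma split_stage_step:
  assumes c: "\<And>j. Suc j < n \<Longrightarrow> 0 < c j" and v: "split_stage n c k m v"
    and d: "\<And>j. Suc j < n \<Longrightarrow> 0 \<le> d j"
    and u: "\<And>e xs. xs \<in> col_seqs n k \<Longrightarrow> u e xs = v xs + e * raise n d v xs"
  shows "\<exists>m'\<ge>m. (\<forall>\<^sub>F e in at_right 0. split_stage n c k m' (u e)) \<and>
    ((\<exists>T\<in>col_seqs n k. codepth n T = Suc m \<and> 0 < raise n d v T) \<longrightarrow> m < m')"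
proof -
  let ?w = "raise n d v" and ?N = "k * (n - k)"
  let ?P = "\<lambda>v. chain_poly n c v [0..<k]"
  obtain S where S: "S \<in> col_seqs n k" "codepth n S = m" "0 < v S" using v by (auto simp: split_stage_def)
  have nonneg: "0 \<le> v ys" if "ys \<in> col_seqs n k" for ys using v that by (auto simp: split_stage_def)
  have zero: "v ys = 0" if "ys \<in> col_seqs n k" "m < codepth n ys" for ys
    using v that by (auto simp: split_stage_def)
  obtain x where "alternates (?P v) ?N m x" using v by (auto simp: split_stage_def)
  hence x: "\<And>i. i < m \<Longrightarrow> x i < x (Suc i)" "x m < 0" "\<And>i. i \<le> m \<Longrightarrow> 0 < (-1) ^ (?N + i) * poly (?P v) (x i)"
    by (auto simp: alternates_def)
  have k: "k \<le> n" using col_seqs_length_le[OF S(1)] .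
  have w0: "0 \<le> ?w ys" if "ys \<in> col_seqs n k" for ys using raise_nonneg[OF that nonneg d] .
  have wzero: "?w ys = 0" if ys: "ys \<in> col_seqs n k" "Suc m < codepth n ys" for ys
    unfolding raise_def
  proof (intro sum.neutral ballI)
    fix p assume p: "p \<in> bumps n ys"
    have "m < codepth n (bump ys p)" using codepth_bump[OF ys(1) p] ys(2) by simp
    thus "d (ys ! p) * v (bump ys p) = 0" using zero[OF bump_col_seqs(2)[OF ys(1) p]] by simp
  qed
  have pos: "\<forall>\<^sub>F e in at_right (0::real). 0 < e" by (simp add: eventually_at_right_less)
  have persist: "\<forall>\<^sub>F e in at_right 0. \<forall>i\<le>m. 0 < (-1) ^ (?N + i) * poly (?P (u e)) (x i)"
    using eventually_alternation_persists[of m ?N "?P v" x "?P ?w"] x(3)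
      chain_poly_add[OF bottom_cols_in[OF k] u] by simp
  show ?thesis
  proof (cases "\<exists>T\<in>col_seqs n k. codepth n T = Suc m \<and> 0 < ?w T")
    case True
    then obtain T where T: "T \<in> col_seqs n k" "codepth n T = Suc m" "0 < ?w T" by blast
    have "\<forall>\<^sub>F e in at_right 0. split_stage n c k (Suc m) (u e)"
      using persist pos
    proof eventually_elim
      case (elim e)
      have ue: "0 \<le> u e ys" if "ys \<in> col_seqs n k" for ys
        using u[OF that] nonneg[OF that] w0[OF that] elim(2) by simp
      have uT: "0 < u e T" using u[OF T(1)] nonneg[OF T(1)] T(3) elim(2) by (simp add: add_nonneg_pos)
      have uz: "u e ys = 0" if "ys \<in> col_seqs n k" "Suc m < codepth n ys" for ys
        using u[OF that(1)] zero[OF that(1)] wzero[OF that] that(2) by simp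
      have "\<forall>\<^sub>F t in at_left 0. 0 < (-1) ^ (?N + Suc m) * poly (?P (u e)) t"
        using c ue T(1,2) uT uz by (rule chain_poly_bottom_sign)
      moreover have "\<forall>\<^sub>F t in at_left 0. x m < t \<and> t < 0"
        using x(2) by (intro eventually_at_leftI[of "x m"]) auto
      ultimately have "\<forall>\<^sub>F t in at_left 0. 0 < (-1) ^ (?N + Suc m) * poly (?P (u e)) t \<and> x m < t \<and> t < 0"
        by (rule eventually_conj)
      from eventually_happens'[OF trivial_limit_at_left_real this]
      obtain t where t: "0 < (-1) ^ (?N + Suc m) * poly (?P (u e)) t" "x m < t" "t < 0" by blast
      have "alternates (?P (u e)) ?N (Suc m) (x(Suc m := t))"
        unfolding alternates_def
      proof (intro conjI allI impI)
        fix i assume "i < Suc m"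
        thus "(x(Suc m := t)) i < (x(Suc m := t)) (Suc i)" using x(1)[of i] t(2) by (cases "i = m") auto
      next
        fix i assume "i \<le> Suc m"
        thus "0 < (-1) ^ (?N + i) * poly (?P (u e)) ((x(Suc m := t)) i)"
          using elim(1)[rule_format, of i] t(1) by (cases "i = Suc m") auto
      qed (simp add: t(3))
      with ue T(1,2) uT uz show ?case by (rule split_stageI)
    qed
    thus ?thesis by (intro exI[of _ "Suc m"]) auto
  next
    case False
    have "\<forall>\<^sub>F e in at_right 0. split_stage n c k m (u e)"
      using persist pos
    proof eventually_elim
      case (elim e)
      have ue: "0 \<le> u e ys" if "ys \<in> col_seqs n k" for ys
        using u[OF that] nonneg[OF that] w0[OF that] elim(2) by simp
      have uS: "0 < u e S" using u[OF S(1)] w0[OF S(1)] S(3) elim(2) by (simp add: add_pos_nonneg)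
      have uz: "u e ys = 0" if ys: "ys \<in> col_seqs n k" "m < codepth n ys" for ys
      proof -
        have "?w ys = 0"
        proof (cases "codepth n ys = Suc m")
          case True
          hence "\<not> 0 < ?w ys" using False ys(1) by blast
          thus ?thesis using w0[OF ys(1)] by simp
        qed (use wzero[OF ys(1)] ys(2) in simp)
        thus ?thesis using u[OF ys(1)] zero[OF ys] by simp
      qed
      have "alternates (?P (u e)) ?N m x" using x elim(1) by (auto simp: alternates_def)
      with ue S(1,2) uS uz show ?case by (rule split_stageI)
    qed
    thus ?thesis using False by (intro exI[of _ m]) auto
  qed
qed

section \<open>Matrices whose model polynomials have all their roots real\<close>

lemma Lo1_mult:
  assumes "A \<in> Lo1 n" "B \<in> Lo1 n"
  shows "A * B \<in> Lo1 n"
proof -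
  have A: "A \<in> carrier_mat n n" and B: "B \<in> carrier_mat n n" using assms by (auto simp: Lo1_def)
  have idx: "(A * B) $$ (i, j) = (\<Sum>l = 0..<n. A $$ (i, l) * B $$ (l, j))" if "i < n" "j < n" for i j
    using A B that by (simp add: scalar_prod_def)
  have zero: "A $$ (i, l) * B $$ (l, j) = 0" if "i < n" "j < n" "l < n" "i < l \<or> l < j" for i j l
    using assms that by (auto simp: Lo1_def)
  have "(A * B) $$ (i, i) = 1" if i: "i < n" for i
  proof -
    have "(A * B) $$ (i, i) = (\<Sum>l = 0..<n. if l = i then A $$ (i, i) * B $$ (i, i) else 0)"
      unfolding idx[OF i i] using zero[OF i i] by (intro sum.cong) (auto simp: neq_iff)
    also have "\<dots> = 1" using i assms by (simp add: Lo1_def)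
    finally show ?thesis .
  qed
  moreover have "(A * B) $$ (i, j) = 0" if "i < n" "j < n" "i < j" for i j
    unfolding idx[OF that(1,2)] using zero[OF that(1,2)] that(3) by (intro sum.neutral) fastforce
  ultimately show ?thesis using A B by (auto simp: Lo1_def)
qed

text \<open>
  The first position with \<open>S ! p \<noteq> p\<close> can be moved to the left, since the columns before it are
  \<open>0, ..., p - 1\<close>.
\<close>

lemma exists_lowering:
  assumes S: "S \<in> col_seqs n k" and ne: "S \<noteq> [0..<k]"
  obtains T p where "T \<in> col_seqs n k" "p \<in> bumps n T" "bump T p = S"
proof -
  have len: "length S = k" using S by (auto simp: col_seqs_def)
  have "\<exists>p<k. S ! p \<noteq> p" using ne len by (metis add_0 diff_zero length_upt nth_equalityI nth_upt)
  define p where "p = (LEAST p. p < k \<and> S ! p \<noteq> p)"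
  have p: "p < k" "S ! p \<noteq> p"
    using LeastI_ex[OF \<open>\<exists>p<k. S ! p \<noteq> p\<close>] by (auto simp: p_def)
  have below: "S ! q = q" if "q < p" for q
    using not_less_Least[of q "\<lambda>p. p < k \<and> S ! p \<noteq> p"] that p(1) by (auto simp: p_def)
  have Sp: "p < S ! p" using col_seqs_lower[OF S p(1)] p(2) by simp
  define T where "T = S[p := S ! p - 1]"
  have T: "T \<in> col_seqs n k"
  proof (rule col_seqsI)
    fix q assume q: "Suc q < k"
    have "S ! q < S ! Suc q" using col_seqs_strict[OF S, of q "Suc q"] q by simp
    thus "T ! q < T ! Suc q" using below[of q] Sp len q p by (auto simp: T_def nth_list_update)
  next
    fix q assume "q < k"
    thus "T ! q < n" using col_seqs_less[OF S \<open>q < k\<close>] len p by (auto simp: T_def nth_list_update)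
  qed (simp add: T_def len)
  have "bump T p = S" using Sp p len by (simp add: T_def bump_def)
  moreover have "p \<in> bumps n T" using calculation S p len by (simp add: bumps_def T_def)
  ultimately show thesis using that T by blast
qed

text \<open>
  One matrix must serve all \<open>k\<close> simultaneously. A column operation never undoes what has been reached for
  any \<open>k\<close>, and for a \<open>k\<close> that is not finished some column operation makes progress. Hence the total
  progress can be increased until every \<open>k\<close> is finished.
\<close>

lemma split_stage_final_exists:
  assumes c: "\<And>j. Suc j < n \<Longrightarrow> 0 < c j"
  shows "\<exists>L\<in>Lo1 n. \<forall>k\<in>{1..n - 1}. split_stage n c k (k * (n - k)) (minor n k L)"
proof -
  define Inv where "Inv L M \<longleftrightarrow> L \<in> Lo1 n \<and> (\<forall>k\<in>{1..n - 1}. split_stage n c k (M k) (minor n k L))" for L M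
  let ?K = "{1..n - 1}" and ?N = "\<lambda>k. k * (n - k)"
  have bound: "M k \<le> ?N k" if "Inv L M" "k \<in> ?K" for L M k
  proof -
    obtain S where "S \<in> col_seqs n k" "codepth n S = M k"
      using \<open>Inv L M\<close> \<open>k \<in> ?K\<close> unfolding Inv_def split_stage_def by blast
    thus ?thesis using codepth_le_bottom by metis
  qed
  have base: "Inv (1\<^sub>m n) (\<lambda>k. 0)"
    unfolding Inv_def
  proof (intro conjI ballI)
    show one: "1\<^sub>m n \<in> Lo1 n" by (auto simp: Lo1_def)
    fix k assume "k \<in> ?K"
    hence k: "k \<le> n" by auto
    let ?v = "minor n k (1\<^sub>m n)"
    have top: "top_cols n k \<in> col_seqs n k" "?v (top_cols n k) = 1" "codepth n (top_cols n k) = 0"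
      using top_cols_in[OF k] minor_top[OF one k] k by (auto simp: codepth_def top_cols_def)
    have nonneg: "0 \<le> ?v ys" if "ys \<in> col_seqs n k" for ys
      using minor_one[OF that] top(2) by (cases "ys = top_cols n k") auto
    have zero: "?v ys = 0" if "ys \<in> col_seqs n k" "0 < codepth n ys" for ys
      using minor_one[OF that(1)] that(2) top(3) by (cases "ys = top_cols n k") auto
    have vtop: "0 < ?v (top_cols n k)" using top(2) by simp
    have "\<forall>\<^sub>F t in at_left 0. 0 < (-1) ^ (?N k + 0) * poly (chain_poly n c ?v [0..<k]) t"
      using c nonneg top(1,3) vtop zero by (rule chain_poly_bottom_sign)
    moreover have "\<forall>\<^sub>F t in at_left (0::real). t < 0" by (simp add: eventually_at_filter)
    ultimately have "\<forall>\<^sub>F t in at_left 0. 0 < (-1) ^ (?N k + 0) * poly (chain_poly n c ?v [0..<k]) t \<and> t < 0"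
      by (rule eventually_conj)
    from eventually_happens'[OF trivial_limit_at_left_real this]
    obtain t where "0 < (-1) ^ (?N k + 0) * poly (chain_poly n c ?v [0..<k]) t" "t < 0" by blast
    hence "alternates (chain_poly n c ?v [0..<k]) (?N k) 0 (\<lambda>_. t)" by (simp add: alternates_def)
    with nonneg top(1,3) vtop zero show "split_stage n c k 0 ?v" by (rule split_stageI)
  qed
  have step: "\<exists>L' M'. Inv L' M' \<and> (\<forall>k\<in>?K. M k \<le> M' k) \<and> M k0 < M' k0"
    if Inv: "Inv L M" and k0: "k0 \<in> ?K" and less: "M k0 < ?N k0" for L M k0
  proof -
    have L: "L \<in> carrier_mat n n" "L \<in> Lo1 n" using Inv by (auto simp: Inv_def Lo1_def)
    obtain S where S: "S \<in> col_seqs n k0" "codepth n S = M k0" "0 < minor n k0 L S"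
      and nonneg: "\<And>ys. ys \<in> col_seqs n k0 \<Longrightarrow> 0 \<le> minor n k0 L ys"
      using Inv k0 unfolding Inv_def split_stage_def by blast
    have "S \<noteq> [0..<k0]" using S(2) less codepth_bottom[of k0 n] k0 by auto
    then obtain T p where T: "T \<in> col_seqs n k0" "p \<in> bumps n T" "bump T p = S"
      using exists_lowering[OF S(1)] by blast
    define j where "j = T ! p"
    have j: "Suc j < n" using bump_col_seqs(3)[OF T(1,2)] by (simp add: j_def)
    let ?d = "\<lambda>l. if l = j then 1 else 0 :: real"
    define u where "u k e = minor n k (L * elementary n j e)" for k e
    have "\<exists>m'. M k \<le> m' \<and> (\<forall>\<^sub>F e in at_right 0. split_stage n c k m' (u k e)) \<and>
        ((\<exists>T\<in>col_seqs n k. codepth n T = Suc (M k) \<and> 0 < raise n ?d (minor n k L) T) \<longrightarrow> M k < m')"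
      if "k \<in> ?K" for k
    proof (rule split_stage_step[OF c])
      show "split_stage n c k (M k) (minor n k L)" using Inv that by (auto simp: Inv_def)
      show "u k e xs = minor n k L xs + e * raise n ?d (minor n k L) xs" if "xs \<in> col_seqs n k" for e xs
        unfolding u_def by (rule minor_mult_elementary[OF L(1) j that])
    qed auto
    then obtain M' where M': "\<And>k. k \<in> ?K \<Longrightarrow> M k \<le> M' k"
      "\<And>k. k \<in> ?K \<Longrightarrow> \<forall>\<^sub>F e in at_right 0. split_stage n c k (M' k) (u k e)"
      "\<And>k. k \<in> ?K \<Longrightarrow> (\<exists>T\<in>col_seqs n k. codepth n T = Suc (M k) \<and> 0 < raise n ?d (minor n k L) T) \<longrightarrow> M k < M' k"
      by metis
    have "0 < raise n ?d (minor n k0 L) T"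
      unfolding raise_def
    proof (rule sum_pos2[OF _ T(2)])
      show "0 < ?d (T ! p) * minor n k0 L (bump T p)" using S(3) T(3) by (simp add: j_def)
      show "0 \<le> ?d (T ! q) * minor n k0 L (bump T q)" if "q \<in> bumps n T" for q
        using nonneg[OF bump_col_seqs(2)[OF T(1) that]] by simp
    qed simp
    moreover have "codepth n T = Suc (M k0)" using codepth_bump[OF T(1,2)] T(3) S(2) by simp
    ultimately have "M k0 < M' k0" using M'(3)[OF k0] T(1) by blast
    have "\<forall>\<^sub>F e in at_right 0. \<forall>k\<in>?K. split_stage n c k (M' k) (u k e)"
      using M'(2) by (intro eventually_ball_finite) auto
    from eventually_happens'[OF trivial_limit_at_right_real this]
    obtain e where "\<forall>k\<in>?K. split_stage n c k (M' k) (u k e)" by blast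
    hence "Inv (L * elementary n j e) M'"
      using Lo1_mult[OF L(2) elementary_Lo1] by (auto simp: Inv_def u_def)
    thus ?thesis using M'(1) \<open>M k0 < M' k0\<close> by blast
  qed
  have "\<exists>L M. Inv L M \<and> (\<forall>k\<in>?K. M k = ?N k)" if "Inv L M" for L M
    using that
  proof (induction "(\<Sum>k\<in>?K. ?N k) - (\<Sum>k\<in>?K. M k)" arbitrary: L M rule: less_induct)
    case less
    show ?case
    proof (cases "\<forall>k\<in>?K. M k = ?N k")
      case False
      then obtain k0 where k0: "k0 \<in> ?K" "M k0 < ?N k0" using bound[OF less.prems] by force
      obtain L' M' where L': "Inv L' M'" "\<forall>k\<in>?K. M k \<le> M' k" "M k0 < M' k0"
        using step[OF less.prems k0] by blast
      have "(\<Sum>k\<in>?K. M k) < (\<Sum>k\<in>?K. M' k)" using L' k0 by (intro sum_strict_mono_ex1) auto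
      moreover have "(\<Sum>k\<in>?K. M' k) \<le> (\<Sum>k\<in>?K. ?N k)" using bound[OF L'(1)] by (rule sum_mono)
      ultimately show ?thesis by (intro less.hyps[OF _ L'(1)]) linarith
    qed (use less.prems in blast)
  qed
  from this[OF base] obtain L M where L: "Inv L M" and M: "\<forall>k\<in>?K. M k = ?N k" by blast
  have "\<forall>k\<in>?K. split_stage n c k (?N k) (minor n k L)"
  proof
    fix k assume k: "k \<in> ?K"
    have "split_stage n c k (M k) (minor n k L)" using L k by (simp only: Inv_def)
    thus "split_stage n c k (?N k) (minor n k L)" using bspec[OF M k] by simp
  qed
  thus ?thesis using L by (auto simp: Inv_def)
qed

lemma Lo1_carrier: "L \<in> Lo1 n \<Longrightarrow> L \<in> carrier_mat n n"
  by (simp add: Lo1_def)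

section \<open>Minors along a flag-convex curve\<close>

lemma mat_inverse_Lo1:
  assumes L: "L \<in> Lo1 n"
  obtains B where "mat_inverse L = Some B" "B \<in> Lo1 n" "L * B = 1\<^sub>m n" "B * L = 1\<^sub>m n"
proof -
  have carr: "L \<in> carrier_mat n n" and diag: "\<And>i. i < n \<Longrightarrow> L $$ (i, i) = 1"
    and upper: "\<And>i j. i < j \<Longrightarrow> j < n \<Longrightarrow> L $$ (i, j) = 0"
    using L by (auto simp: Lo1_def)
  have "det L = prod_list (diag_mat L)" using det_lower_triangular[OF upper carr] by simp
  also have "diag_mat L = map (\<lambda>i. 1) [0..<n]"
    using carr diag by (auto simp: diag_mat_def)
  finally have "det L \<noteq> 0" by (simp add: map_replicate_const)
  hence "L \<in> Units (ring_mat TYPE(real) n n)" by (rule det_non_zero_imp_unit[OF carr])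
  then obtain B where B: "mat_inverse L = Some B"
    using mat_inverse(1)[OF carr, where b = n] by (cases "mat_inverse L") auto
  hence inv: "L * B = 1\<^sub>m n" "B * L = 1\<^sub>m n" "B \<in> carrier_mat n n"
    using mat_inverse(2)[OF carr B] by auto
  have entry: "i \<le> j \<Longrightarrow> j < n \<Longrightarrow> B $$ (i, j) = (if i = j then 1 else 0)" for i j
  proof (induction i arbitrary: j rule: less_induct)
    case (less i)
    have i: "i < n" using less.prems by simp
    have "(\<Sum>l = 0..<n. L $$ (i, l) * B $$ (l, j)) = (L * B) $$ (i, j)"
      using carr inv(3) i less.prems by (simp add: scalar_prod_def)
    also have "\<dots> = (if i = j then 1 else 0)" using inv(1) i less.prems by simp
    also have "(\<Sum>l = 0..<n. L $$ (i, l) * B $$ (l, j)) =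
        (\<Sum>l = 0..<n. if l = i then L $$ (i, i) * B $$ (i, j) else 0)"
    proof (rule sum.cong)
      fix l assume l: "l \<in> {0..<n}"
      show "L $$ (i, l) * B $$ (l, j) = (if l = i then L $$ (i, i) * B $$ (i, j) else 0)"
      proof (cases l i rule: linorder_cases)
        case less
        hence "B $$ (l, j) = 0" using less.IH[of l j] less.prems by simp
        thus ?thesis using less by simp
      qed (use upper l in auto)
    qed simp
    also have "\<dots> = B $$ (i, j)" using i diag by simp
    finally show ?case .
  qed
  have "B \<in> Lo1 n" using inv(3) entry by (auto simp: Lo1_def)
  thus thesis using that B inv by blast
qed

text \<open>
  From the first \<open>k\<close> columns only the last can be bumped. So \<open>m_k'\<close> is a multiple of a single minor, and
  a column operation changes \<open>m_k\<close> only if it acts on the last of its columns.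
\<close>

lemma raise_bottom:
  assumes "0 < k" "k < n"
  shows "raise n c v [0..<k] = c (k - 1) * v (bump [0..<k] (k - 1))"
proof -
  have "bumps n [0..<k] = {k - 1}"
  proof (intro equalityI subsetI)
    fix p assume p: "p \<in> bumps n [0..<k]"
    have b: "[0..<k] \<in> col_seqs n k" using bottom_cols_in assms by simp
    note * = bump_col_seqs[OF b p]
    show "p \<in> {k - 1}"
    proof (rule ccontr)
      assume "p \<notin> {k - 1}"
      hence "Suc p < k" using *(1) by simp
      hence "bump [0..<k] p ! p < bump [0..<k] p ! Suc p" using col_seqs_strict[OF *(2)] by simp
      thus False using \<open>Suc p < k\<close> by (simp add: bump_def)
    qed
  next
    fix p assume "p \<in> {k - 1}"
    moreover have "bump [0..<k] (k - 1) \<in> col_seqs n k"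
      using assms by (intro col_seqsI) (auto simp: bump_def nth_list_update)
    ultimately show "p \<in> bumps n [0..<k]" using assms by (simp add: bumps_def)
  qed
  thus ?thesis using assms by (simp add: raise_def)
qed

text \<open>
  The factor \<open>s\<close> on the right is the one that the chain rule produces for the time change
  \<open>t \<mapsto> t0 + s * t\<close>.
\<close>

lemma raise_rescale:
  assumes "xs \<in> col_seqs n k" "s > 0"
  shows "raise n c (\<lambda>ys. v ys / s ^ codepth n ys) xs = s / s ^ codepth n xs * raise n c v xs"
  unfolding raise_def sum_distrib_left
proof (intro sum.cong refl)
  fix p assume p: "p \<in> bumps n xs"
  show "c (xs ! p) * (v (bump xs p) / s ^ codepth n (bump xs p)) =
      s / s ^ codepth n xs * (c (xs ! p) * v (bump xs p))"
    using assms(2) by (simp add: codepth_bump[OF assms(1) p])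
qed

lemma finite_separated:
  assumes "finite (R :: real set)"
  obtains \<eta> where "0 < \<eta>" "\<And>p q. p \<in> R \<Longrightarrow> q \<in> R \<Longrightarrow> p \<noteq> q \<Longrightarrow> 2 * \<eta> < \<bar>p - q\<bar>"
proof -
  have "\<forall>\<^sub>F r in at_right 0. \<forall>p\<in>R. \<forall>q\<in>R. p \<noteq> q \<longrightarrow> 2 * r < \<bar>p - q\<bar>"
  proof (intro eventually_ball_finite ballI assms)
    fix p q assume "p \<in> R" "q \<in> R"
    show "\<forall>\<^sub>F r in at_right 0. p \<noteq> q \<longrightarrow> 2 * r < \<bar>p - q\<bar>"
    proof (cases "p = q")
      case False
      thus ?thesis by (intro eventually_at_rightI[of 0 "\<bar>p - q\<bar> / 2"]) auto
    qed simp
  qed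
  hence "\<forall>\<^sub>F r in at_right 0. (\<forall>p\<in>R. \<forall>q\<in>R. p \<noteq> q \<longrightarrow> 2 * r < \<bar>p - q\<bar>) \<and> (0::real) < r"
    by (rule eventually_conj) (simp add: eventually_at_right_less)
  from eventually_happens'[OF trivial_limit_at_right_real this] show thesis using that by blast
qed

locale flag_convex_curve =
  fixes n :: nat and I :: "real set" and \<Gamma> :: "real \<Rightarrow> real mat"
  assumes interval: "is_interval I" and nondegenerate: "\<exists>a\<in>I. \<exists>b\<in>I. a < b"
    and flag_convex: "flag_convex n I \<Gamma>"
begin

definition speed :: "nat \<Rightarrow> real \<Rightarrow> real" where
  "speed j t = log_derivative n I \<Gamma> t $$ (Suc j, j)"

lemma speed_pos: "Suc j < n \<Longrightarrow> t \<in> I \<Longrightarrow> 0 < speed j t"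
  using flag_convex unfolding flag_convex_def speed_def
  by (metis Suc_eq_plus1 Suc_lessD)

lemma curve_Lo1: "t \<in> I \<Longrightarrow> \<Gamma> t \<in> Lo1 n"
  using flag_convex by (auto simp: flag_convex_def smooth_Lo1_curve_def)

lemma not_isolated: "t \<in> I \<Longrightarrow> at t within I \<noteq> bot"
proof -
  assume t: "t \<in> I"
  have "connected I" using interval by (simp add: is_interval_connected_1)
  moreover have "I \<noteq> {t}" using nondegenerate by auto
  ultimately have "t islimpt I" using connected_imp_perfect[of I t] t by blast
  thus "at t within I \<noteq> bot" using trivial_limit_within by blast
qed

lemma curve_smooth:
  assumes "i < n" "j < n"
  obtains D where "\<And>t. t \<in> I \<Longrightarrow> ((\<lambda>s. \<Gamma> s $$ (i, j)) has_real_derivative D t) (at t within I)"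
    "continuous_on I D"
proof -
  have "smooth_on I (\<lambda>t. \<Gamma> t $$ (i, j))"
    using flag_convex assms by (auto simp: flag_convex_def smooth_Lo1_curve_def)
  then obtain D where D0: "\<And>t. t \<in> I \<Longrightarrow> D 0 t = \<Gamma> t $$ (i, j)"
    and D: "\<And>k t. t \<in> I \<Longrightarrow> (D k has_real_derivative D (Suc k) t) (at t within I)"
    unfolding smooth_on_def by blast
  have "((\<lambda>s. \<Gamma> s $$ (i, j)) has_real_derivative D 1 t) (at t within I)" if t: "t \<in> I" for t
  proof -
    have "(D 0 has_derivative (*) (D 1 t)) (at t within I)"
      using D[OF t, of 0] by (simp add: has_field_derivative_def)
    thus ?thesis unfolding has_field_derivative_def
      by (rule has_derivative_transform[OF t, rotated]) (simp add: D0)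
  qed
  moreover have "continuous_on I (D 1)" by (rule DERIV_continuous_on) (rule D)
  ultimately show thesis by (rule that)
qed

text \<open>
  The equation \<open>\<Gamma>' = \<Gamma> A\<close>, entry by entry.
\<close>

lemma curve_derivative:
  assumes t: "t \<in> I" and ij: "i < n" "j < n"
  shows "((\<lambda>s. \<Gamma> s $$ (i, j)) has_real_derivative
    (if Suc j < n then speed j t * \<Gamma> t $$ (i, Suc j) else 0)) (at t within I)"
proof -
  obtain D where D: "\<And>t. t \<in> I \<Longrightarrow> ((\<lambda>s. \<Gamma> s $$ (i, j)) has_real_derivative D t) (at t within I)"
    using curve_smooth[OF ij] by blast
  obtain B where B: "mat_inverse (\<Gamma> t) = Some B" "B \<in> Lo1 n" "\<Gamma> t * B = 1\<^sub>m n" "B * \<Gamma> t = 1\<^sub>m n"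
    using mat_inverse_Lo1[OF curve_Lo1[OF t]] by blast
  let ?A = "log_derivative n I \<Gamma> t" and ?M = "mat_derivative n I \<Gamma> t"
  have carr: "\<Gamma> t \<in> carrier_mat n n" "B \<in> carrier_mat n n" "?M \<in> carrier_mat n n"
    using curve_Lo1[OF t] B(2) by (auto simp: Lo1_def mat_derivative_def)
  have A: "?A = B * ?M" by (simp add: log_derivative_def B)
  have "\<Gamma> t * ?A = (\<Gamma> t * B) * ?M" unfolding A using carr by (simp add: assoc_mult_mat)
  hence M: "?M = \<Gamma> t * ?A" using B(3) carr by simp
  have shape: "?A $$ (l, j) = (if l = Suc j then speed j t else 0)" if "l < n" for l
    using flag_convex t that ij(2) unfolding flag_convex_def speed_def
    by (metis Suc_eq_plus1)
  have "D t = vector_derivative (\<lambda>s. \<Gamma> s $$ (i, j)) (at t within I)"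
    by (rule vector_derivative_within[OF not_isolated[OF t], symmetric])
      (use D[OF t] in \<open>simp add: has_real_derivative_iff_has_vector_derivative\<close>)
  also have "\<dots> = ?M $$ (i, j)" using ij by (simp add: mat_derivative_def)
  also have "\<dots> = (\<Sum>l = 0..<n. \<Gamma> t $$ (i, l) * ?A $$ (l, j))"
    unfolding M using ij carr by (simp add: A scalar_prod_def)
  also have "\<dots> = (\<Sum>l = 0..<n. if l = Suc j then speed j t * \<Gamma> t $$ (i, Suc j) else 0)"
    by (intro sum.cong) (auto simp: shape)
  also have "\<dots> = (if Suc j < n then speed j t * \<Gamma> t $$ (i, Suc j) else 0)" by simp
  finally show ?thesis using D[OF t] by simp
qed

lemma speed_continuous:
  assumes j: "Suc j < n"
  shows "continuous_on I (speed j)"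
proof -
  have j': "j < n" using j by simp
  obtain D where D: "\<And>t. t \<in> I \<Longrightarrow> ((\<lambda>s. \<Gamma> s $$ (Suc j, j)) has_real_derivative D t) (at t within I)"
    and cont: "continuous_on I D"
    using curve_smooth[OF j j'] by blast
  have "speed j t = D t" if t: "t \<in> I" for t
  proof -
    have "((\<lambda>s. \<Gamma> s $$ (Suc j, j)) has_real_derivative speed j t) (at t within I)"
      using curve_derivative[OF t j j'] j curve_Lo1[OF t] by (simp add: Lo1_def)
    thus ?thesis
      using D[OF t] vector_derivative_unique_within[OF not_isolated[OF t]]
      by (metis has_real_derivative_iff_has_vector_derivative)
  qed
  thus ?thesis using cont by (simp cong: continuous_on_cong)
qed

lemma chain_system_curve:
  assumes L: "L \<in> carrier_mat n n"
  shows "chain_system n k I speed (\<lambda>xs t. minor n k (L * \<Gamma> t) xs)"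
  unfolding chain_system_def
proof (intro ballI)
  fix xs t assume xs: "xs \<in> col_seqs n k" and t: "t \<in> I"
  have idx: "(L * \<Gamma> s) $$ (i, j) = (\<Sum>l = 0..<n. L $$ (i, l) * \<Gamma> s $$ (l, j))"
    if "s \<in> I" "i < n" "j < n" for s i j
    using L curve_Lo1[OF that(1)] that by (auto simp: Lo1_def scalar_prod_def)
  show "((\<lambda>t. minor n k (L * \<Gamma> t) xs) has_real_derivative
      raise n (\<lambda>j. speed j t) (\<lambda>ys. minor n k (L * \<Gamma> t) ys) xs) (at t within I)"
  proof (rule minor_has_derivative[OF _ xs])
    fix i j assume ij: "i < n" "j < n"
    have "((\<lambda>s. \<Sum>l = 0..<n. L $$ (i, l) * \<Gamma> s $$ (l, j)) has_real_derivative
        (\<Sum>l = 0..<n. L $$ (i, l) * (if Suc j < n then speed j t * \<Gamma> t $$ (l, Suc j) else 0))) (at t within I)"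
      using ij by (intro DERIV_sum DERIV_cmult curve_derivative t) auto
    also have "(\<Sum>l = 0..<n. L $$ (i, l) * (if Suc j < n then speed j t * \<Gamma> t $$ (l, Suc j) else 0)) =
        (if Suc j < n then speed j t * (L * \<Gamma> t) $$ (i, Suc j) else 0)"
      using idx[OF t ij(1), of "Suc j"] by (simp add: sum_distrib_left mult_ac)
    finally show "((\<lambda>s. (L * \<Gamma> s) $$ (i, j)) has_real_derivative
        (if Suc j < n then speed j t * (L * \<Gamma> t) $$ (i, Suc j) else 0)) (at t within I)"
      unfolding has_field_derivative_def
      by (rule has_derivative_transform[OF t, rotated]) (simp add: idx ij)
  qed
qed

section \<open>Choice of the matrix\<close>

text \<open>
  The sign conditions at \<open>a\<close> and \<open>b\<close> exclude roots outside of \<open>[a, b]\<close>; the last condition says that the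
  derivative of the minor does not vanish at its roots. All conditions are open in \<open>L\<close>.
\<close>

definition fully_split :: "real \<Rightarrow> real \<Rightarrow> real mat \<Rightarrow> bool" where
  "fully_split a b L \<longleftrightarrow> L \<in> Lo1 n \<and> (\<forall>k\<in>{1..n - 1}.
     (\<forall>xs\<in>col_seqs n k. 0 < minor n k (L * \<Gamma> b) xs \<and> 0 < (-1) ^ codepth n xs * minor n k (L * \<Gamma> a) xs) \<and>
     card (roots_on {a..b} (\<lambda>t. minor n k (L * \<Gamma> t) [0..<k])) = k * (n - k) \<and>
     (\<forall>t\<in>roots_on {a..b} (\<lambda>t. minor n k (L * \<Gamma> t) [0..<k]).
        raise n (\<lambda>j. speed j t) (minor n k (L * \<Gamma> t)) [0..<k] \<noteq> 0))"


text \<open>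
  Take \<open>L0\<close> with real-rooted model polynomials \<open>P\<close> and a bound \<open>B\<close> on their roots such that at \<open>B\<close> and
  at \<open>- B\<close> all components of \<open>P\<close> have the signs of their leading terms. The rescaled minors \<open>h\<close> of the conjugates of \<open>L0\<close>, multiplied by the inverse
  of \<open>\<Gamma> t0\<close>, take the same initial values as \<open>P\<close> and satisfy a system whose coefficients converge to the
  constants \<open>speed j t0\<close>. So for small \<open>s\<close> they inherit the signs at \<open>- B\<close> and \<open>B\<close> and the number of
  simple roots in between.
\<close>

lemma fully_split_near:
  assumes r: "0 < r" and sub: "{t0 - r..t0 + r} \<subseteq> I"
  obtains a b L where "t0 - r \<le> a" "a < b" "b \<le> t0 + r" "fully_split a b L"
proof -
  have t0: "t0 \<in> I" using r sub by auto
  define c where "c j = speed j t0" for j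
  have c: "0 < c j" if "Suc j < n" for j using speed_pos[OF that t0] by (simp add: c_def)
  obtain L0 where L0: "L0 \<in> Lo1 n" and splits: "\<And>k. k \<in> {1..n - 1} \<Longrightarrow> split_stage n c k (k * (n - k)) (minor n k L0)"
    using split_stage_final_exists[of n c, OF c] by blast
  have L0c: "L0 \<in> carrier_mat n n" using Lo1_carrier[OF L0] .
  define P where "P k = chain_poly n c (minor n k L0)" for k
  define P' where "P' k t = raise n c (\<lambda>ys. poly (P k ys) t) [0..<k]" for k t
  have leading: "\<forall>\<^sub>F t in at_top. 0 < poly (P k xs) t \<and> 0 < (-1) ^ codepth n xs * poly (P k xs) (- t)"
    if k: "k \<in> {1..n - 1}" and xs: "xs \<in> col_seqs n k" for k xs
  proof (rule poly_sign_near_infinity)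
    show "degree (P k xs) \<le> codepth n xs" unfolding P_def by (rule degree_chain_poly)
    have kn: "k \<le> n" using k by auto
    have "0 < (raise n c ^^ codepth n xs) (minor n k L0) xs"
    proof (rule raise_power_pos[OF xs top_cols_in[OF kn]])
      show "xs ! p \<le> top_cols n k ! p" if "p < k" for p
        using col_seqs_upper[OF xs that] top_cols_nth[OF kn that] by simp
      show "codepth n (top_cols n k) + codepth n xs = codepth n xs"
        using kn by (simp add: codepth_def top_cols_def)
      show "0 < minor n k L0 (top_cols n k)" using minor_top[OF L0 kn] by simp
      show "0 \<le> minor n k L0 ys" if "ys \<in> col_seqs n k" for ys
        using splits[OF k] that by (simp add: split_stage_def)
    qed (rule c)
    thus "0 < coeff (P k xs) (codepth n xs)" unfolding P_def coeff_chain_poly[OF xs] by simp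
  qed
  have bot: "[0..<k] \<in> col_seqs n k" if "k \<in> {1..n - 1}" for k
    by (rule bottom_cols_in) (use that in auto)
  have P_roots: "P k [0..<k] \<noteq> 0" "card {t. poly (P k [0..<k]) t = 0} = k * (n - k)"
    if k: "k \<in> {1..n - 1}" for k
  proof -
    let ?p = "P k [0..<k]"
    show "?p \<noteq> 0"
    proof
      assume "?p = 0"
      thus False using eventually_happens'[OF trivial_limit_at_top_linorder leading[OF k bot[OF k]]] by simp
    qed
    have kn: "k \<le> n" using k by auto
    obtain x where "alternates ?p (k * (n - k)) (k * (n - k)) x"
      using splits[OF k] unfolding split_stage_def P_def by blast
    hence "k * (n - k) \<le> card {t. poly ?p t = 0}" using \<open>?p \<noteq> 0\<close> by (rule alternates_card_roots)
    moreover have "card {t. poly ?p t = 0} \<le> degree ?p" using card_poly_roots_bound[OF \<open>?p \<noteq> 0\<close>] .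
    moreover have "degree ?p \<le> k * (n - k)"
      using degree_chain_poly[of n c "minor n k L0" "[0..<k]"] codepth_bottom[OF kn] by (simp add: P_def)
    ultimately show "card {t. poly ?p t = 0} = k * (n - k)" by simp
  qed
  have P_simple: "P' k t \<noteq> 0" if k: "k \<in> {1..n - 1}" and root: "poly (P k [0..<k]) t = 0" for k t
  proof -
    have kn: "k \<le> n" using k by auto
    have "degree (P k [0..<k]) \<le> card {t. poly (P k [0..<k]) t = 0}"
      using degree_chain_poly[of n c "minor n k L0" "[0..<k]"] codepth_bottom[OF kn] P_roots(2)[OF k]
      by (simp add: P_def)
    hence "poly (pderiv (P k [0..<k])) t \<noteq> 0" by (rule poly_max_roots_simple[OF P_roots(1)[OF k] _ root])
    moreover have "poly (pderiv (P k [0..<k])) t = P' k t"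
      unfolding P'_def P_def pderiv_chain_poly[OF bot[OF k]] raise_def by (simp add: poly_sum)
    ultimately show ?thesis by simp
  qed
  have "\<forall>\<^sub>F B in at_top. \<forall>k\<in>{1..n - 1}. (\<forall>xs\<in>col_seqs n k. 0 < poly (P k xs) B \<and>
      0 < (-1) ^ codepth n xs * poly (P k xs) (- B)) \<and> (\<forall>t\<in>{t. poly (P k [0..<k]) t = 0}. \<bar>t\<bar> < B)"
  proof (rule eventually_ball_finite)
    show "\<forall>k\<in>{1..n - 1}. \<forall>\<^sub>F B in at_top. (\<forall>xs\<in>col_seqs n k. 0 < poly (P k xs) B \<and>
      0 < (-1) ^ codepth n xs * poly (P k xs) (- B)) \<and> (\<forall>t\<in>{t. poly (P k [0..<k]) t = 0}. \<bar>t\<bar> < B)"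
    proof (intro ballI eventually_conj)
      fix k assume k: "k \<in> {1..n - 1}"
      show "\<forall>\<^sub>F B in at_top. \<forall>xs\<in>col_seqs n k. 0 < poly (P k xs) B \<and>
          0 < (-1) ^ codepth n xs * poly (P k xs) (- B)"
        by (intro eventually_ball_finite[OF finite_col_seqs] ballI leading[OF k])
      show "\<forall>\<^sub>F B in at_top. \<forall>t\<in>{t. poly (P k [0..<k]) t = 0}. \<bar>t\<bar> < B"
        by (intro eventually_ball_finite[OF poly_roots_finite[OF P_roots(1)[OF k]]] ballI eventually_gt_at_top)
    qed
  qed simp
  hence "\<forall>\<^sub>F B in at_top. (\<forall>k\<in>{1..n - 1}. (\<forall>xs\<in>col_seqs n k. 0 < poly (P k xs) B \<and>
      0 < (-1) ^ codepth n xs * poly (P k xs) (- B)) \<and> (\<forall>t\<in>{t. poly (P k [0..<k]) t = 0}. \<bar>t\<bar> < B)) \<and> 0 < B"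
    by (rule eventually_conj) (rule eventually_gt_at_top)
  from eventually_happens'[OF trivial_limit_at_top_linorder this]
  obtain B where Bk: "\<forall>k\<in>{1..n - 1}. (\<forall>xs\<in>col_seqs n k. 0 < poly (P k xs) B \<and>
      0 < (-1) ^ codepth n xs * poly (P k xs) (- B)) \<and> (\<forall>t\<in>{t. poly (P k [0..<k]) t = 0}. \<bar>t\<bar> < B)"
    and B: "0 < B" by (elim exE conjE)
  have B_sign: "0 < poly (P k xs) B" "0 < (-1) ^ codepth n xs * poly (P k xs) (- B)"
    if "k \<in> {1..n - 1}" "xs \<in> col_seqs n k" for k xs using bspec[OF Bk that(1)] that(2) by simp_all
  have P_roots_B: "roots_on {-B..B} (poly (P k [0..<k])) = {t. poly (P k [0..<k]) t = 0}"
    if "k \<in> {1..n - 1}" for k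
    using bspec[OF Bk that] by (fastforce simp: roots_on_def)
  obtain Binv where Binv: "Binv \<in> Lo1 n" "Binv * \<Gamma> t0 = 1\<^sub>m n"
    using mat_inverse_Lo1[OF curve_Lo1[OF t0]] by blast
  define Ls where "Ls s = mat n n (\<lambda>(i, j). s ^ i * inverse s ^ j * L0 $$ (i, j))" for s
  have Ls: "Ls s \<in> Lo1 n" if "0 < s" for s
    using L0 that by (auto simp: Lo1_def Ls_def power_mult_distrib[symmetric])
  \<comment> \<open>the second factor lets the curve \<open>Binv * \<Gamma>\<close> pass through the identity at \<open>t0\<close>\<close>
  define K where "K s = Ls s * Binv" for s
  have K: "K s \<in> Lo1 n" if "0 < s" for s using Lo1_mult[OF Ls[OF that] Binv(1)] by (simp add: K_def)
  define h where "h k s xs t = minor n k (K s * \<Gamma> (t0 + s * t)) xs / s ^ codepth n xs" for k s xs t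
  define h' where "h' k s t = raise n (\<lambda>j. speed j (t0 + s * t)) (\<lambda>ys. h k s ys t) [0..<k]" for k s t
  have h_0: "h k s xs 0 = minor n k L0 xs" if s: "0 < s" and xs: "xs \<in> col_seqs n k" for k s xs
  proof -
    have "K s * \<Gamma> t0 = Ls s * (Binv * \<Gamma> t0)"
      unfolding K_def using Lo1_carrier[OF Ls[OF s]] Lo1_carrier[OF Binv(1)] Lo1_carrier[OF curve_Lo1[OF t0]]
      by (rule assoc_mult_mat)
    also have "\<dots> = Ls s" using Lo1_carrier[OF Ls[OF s]] Binv(2) by simp
    finally have "K s * \<Gamma> t0 = Ls s" .
    thus ?thesis using minor_scale[OF xs s L0c] s by (simp add: h_def Ls_def)
  qed
  have small: "\<forall>\<^sub>F s in at_right 0. 0 < s \<and> s * B < r"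
  proof (rule eventually_at_rightI[of 0 "r / B"])
    show "0 < s \<and> s * B < r" if "s \<in> {0<..<r / B}" for s
      using that B by (simp add: pos_less_divide_eq)
  qed (use r B in simp)
  have inside: "t0 + s * t \<in> {t0 - s * B..t0 + s * B}" if "0 < s" "t \<in> {-B..B}" for s t
  proof -
    have "s * (- B) \<le> s * t" "s * t \<le> s * B" using that mult_left_mono[of "- B" t s] mult_left_mono[of t B s] by auto
    thus ?thesis by (simp only: atLeastAtMost_iff) linarith
  qed
  have inside_I: "{t0 - s * B..t0 + s * B} \<subseteq> I" if "s * B < r" for s
    using sub that by (auto simp: subset_iff)
  have chain: "chain_system n k {-B..B} (\<lambda>j t. speed j (t0 + s * t)) (h k s)"
    if s: "0 < s \<and> s * B < r" for k s
    unfolding chain_system_def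
  proof (intro ballI)
    fix xs t assume xs: "xs \<in> col_seqs n k" and t: "t \<in> {-B..B}"
    let ?g = "\<lambda>t. t0 + s * t"
    let ?R = "raise n (\<lambda>j. speed j (?g t)) (minor n k (K s * \<Gamma> (?g t))) xs"
    have img: "?g ` {-B..B} \<subseteq> I" using inside inside_I s by blast
    have "((\<lambda>u. minor n k (K s * \<Gamma> u) xs) has_real_derivative ?R) (at (?g t) within ?g ` {-B..B})"
      by (rule chain_systemD[OF chain_system_subset[OF chain_system_curve[OF Lo1_carrier[OF K]] img] xs])
        (use s t in auto)
    moreover have "(?g has_real_derivative s) (at t within {-B..B})"
      by (auto intro!: derivative_eq_intros)
    ultimately have "((\<lambda>u. minor n k (K s * \<Gamma> (?g u)) xs) has_real_derivative ?R * s) (at t within {-B..B})"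
      using DERIV_image_chain[of "\<lambda>u. minor n k (K s * \<Gamma> u) xs" ?R ?g t "{-B..B}" s] by (simp add: o_def)
    hence "(h k s xs has_real_derivative ?R * s / s ^ codepth n xs) (at t within {-B..B})"
      unfolding h_def by (rule DERIV_cdivide)
    also have "?R * s / s ^ codepth n xs = raise n (\<lambda>j. speed j (?g t)) (\<lambda>ys. h k s ys t) xs"
      unfolding h_def using raise_rescale[OF xs, of s] s by simp
    finally show "(h k s xs has_real_derivative raise n (\<lambda>j. speed j (?g t)) (\<lambda>ys. h k s ys t) xs)
      (at t within {-B..B})" .
  qed
  have speed_lim: "uniform_limit {-B..B} (\<lambda>s t. speed j (t0 + s * t)) (\<lambda>t. c j) (at_right 0)"
    if j: "Suc j < n" for j
    unfolding uniform_limit_iff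
  proof (intro allI impI)
    fix e :: real assume "e > 0"
    then obtain d where d: "d > 0" "\<And>u. u \<in> I \<Longrightarrow> dist u t0 < d \<Longrightarrow> dist (speed j u) (c j) < e"
      using speed_continuous[OF j] t0 unfolding continuous_on_iff c_def by blast
    have "\<forall>\<^sub>F s in at_right 0. s * B < d"
    proof (rule eventually_at_rightI[of 0 "d / B"])
      show "s * B < d" if "s \<in> {0<..<d / B}" for s
        using that B by (simp add: pos_less_divide_eq)
    qed (use d B in simp)
    with small show "\<forall>\<^sub>F s in at_right 0. \<forall>t\<in>{-B..B}. dist (speed j (t0 + s * t)) (c j) < e"
    proof eventually_elim
      case (elim s)
      show ?case
      proof
        fix t assume t: "t \<in> {-B..B}"
        have *: "t0 + s * t \<in> {t0 - s * B..t0 + s * B}" using inside elim t by blast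
        show "dist (speed j (t0 + s * t)) (c j) < e"
        proof (rule d(2))
          show "t0 + s * t \<in> I" using * inside_I elim by blast
          have "\<bar>s * t\<bar> \<le> s * B" using * unfolding atLeastAtMost_iff by linarith
          thus "dist (t0 + s * t) t0 < d" using elim by (simp add: dist_real_def)
        qed
      qed
    qed
  qed
  have init: "((\<lambda>s. h k s ys 0) \<longlongrightarrow> poly (P k ys) 0) (at_right 0)" if "ys \<in> col_seqs n k" for k ys
  proof (rule tendsto_eventually)
    show "\<forall>\<^sub>F s in at_right 0. h k s ys 0 = poly (P k ys) 0"
      using small
    proof eventually_elim
      case (elim s)
      thus ?case using h_0[OF _ that] poly_chain_poly_0[OF that] by (simp add: P_def)
    qed
  qed
  have lim: "uniform_limit {-B..B} (\<lambda>s. h k s xs) (poly (P k xs)) (at_right 0)"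
    "uniform_limit {-B..B} (\<lambda>s t. raise n (\<lambda>j. speed j (t0 + s * t)) (\<lambda>ys. h k s ys t) xs)
      (\<lambda>t. raise n c (\<lambda>ys. poly (P k ys) t) xs) (at_right 0)"
    if "xs \<in> col_seqs n k" for k xs
  proof -
    have ev: "\<forall>\<^sub>F s in at_right 0. chain_system n k {-B..B} (\<lambda>j t. speed j (t0 + s * t)) (h k s)"
      using small by (rule eventually_mono) (rule chain)
    have g0: "chain_system n k {-B..B} (\<lambda>j t. c j) (\<lambda>xs. poly (P k xs))"
      unfolding P_def by (rule chain_system_chain_poly)
    have zero: "0 \<in> {-B..B}" using B by simp
    note lim = chain_system_uniform_limit[OF ev g0 zero speed_lim continuous_on_const init that]
    show "uniform_limit {-B..B} (\<lambda>s. h k s xs) (poly (P k xs)) (at_right 0)" by (rule lim(1))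
    show "uniform_limit {-B..B} (\<lambda>s t. raise n (\<lambda>j. speed j (t0 + s * t)) (\<lambda>ys. h k s ys t) xs)
      (\<lambda>t. raise n c (\<lambda>ys. poly (P k ys) t) xs) (at_right 0)" by (rule lim(2))
  qed
  have signs: "\<forall>\<^sub>F s in at_right 0. 0 < h k s xs B \<and> 0 < (-1) ^ codepth n xs * h k s xs (- B)"
    if k: "k \<in> {1..n - 1}" and xs: "xs \<in> col_seqs n k" for k xs
  proof -
    have "((\<lambda>s. h k s xs B) \<longlongrightarrow> poly (P k xs) B) (at_right 0)"
      using tendsto_uniform_limitI[OF lim(1)[OF xs]] B by simp
    moreover have "((\<lambda>s. (-1) ^ codepth n xs * h k s xs (- B)) \<longlongrightarrow> (-1) ^ codepth n xs * poly (P k xs) (- B)) (at_right 0)"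
      using tendsto_uniform_limitI[OF lim(1)[OF xs]] B by (intro tendsto_mult_left) simp
    ultimately show ?thesis
      using B_sign[OF k xs] by (intro eventually_conj order_tendstoD(1))
  qed
  have roots: "\<forall>\<^sub>F s in at_right 0. finite (roots_on {-B..B} (h k s [0..<k])) \<and>
      card (roots_on {-B..B} (h k s [0..<k])) = card (roots_on {-B..B} (poly (P k [0..<k]))) \<and>
      (\<forall>t\<in>roots_on {-B..B} (h k s [0..<k]). h' k s t \<noteq> 0) \<and>
      (\<forall>p\<in>roots_on {-B..B} (poly (P k [0..<k])). \<exists>q\<in>roots_on {-B..B} (h k s [0..<k]). \<bar>q - p\<bar> < 1)"
    if k: "k \<in> {1..n - 1}" for k
  proof (rule simple_roots_stable[where f' = "P' k"])
    show deriv: "(poly (P k [0..<k]) has_real_derivative P' k t) (at t within {-B..B})" if "t \<in> {-B..B}" for t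
      unfolding P'_def P_def by (rule chain_systemD[OF chain_system_chain_poly bot[OF k] that])
    show "continuous_on {-B..B} (P' k)" unfolding P'_def raise_def by (intro continuous_intros)
    show "poly (P k [0..<k]) (- B) \<noteq> 0" "poly (P k [0..<k]) B \<noteq> 0"
      using B_sign[OF k bot[OF k]] by auto
    show "finite (roots_on {-B..B} (poly (P k [0..<k])))"
      unfolding P_roots_B[OF k] by (rule poly_roots_finite[OF P_roots(1)[OF k]])
    show "P' k t \<noteq> 0" if "t \<in> roots_on {-B..B} (poly (P k [0..<k]))" for t
      using that P_simple[OF k] by (simp add: roots_on_def)
    show "\<forall>\<^sub>F s in at_right 0. \<forall>t\<in>{-B..B}. (h k s [0..<k] has_real_derivative h' k s t) (at t within {-B..B})"
      using small unfolding h'_def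
      by (rule eventually_mono) (intro ballI chain_systemD[OF chain bot[OF k]])
    show "uniform_limit {-B..B} (\<lambda>s. h k s [0..<k]) (poly (P k [0..<k])) (at_right 0)"
      by (rule lim(1)[OF bot[OF k]])
    show "uniform_limit {-B..B} (h' k) (P' k) (at_right 0)"
      unfolding h'_def P'_def by (rule lim(2)[OF bot[OF k]])
  qed simp
  have "\<forall>\<^sub>F s in at_right 0. (0 < s \<and> s * B < r) \<and>
      (\<forall>k\<in>{1..n - 1}. (\<forall>xs\<in>col_seqs n k. 0 < h k s xs B \<and> 0 < (-1) ^ codepth n xs * h k s xs (- B)) \<and>
        (finite (roots_on {-B..B} (h k s [0..<k])) \<and>
        card (roots_on {-B..B} (h k s [0..<k])) = card (roots_on {-B..B} (poly (P k [0..<k]))) \<and>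
        (\<forall>t\<in>roots_on {-B..B} (h k s [0..<k]). h' k s t \<noteq> 0) \<and>
        (\<forall>p\<in>roots_on {-B..B} (poly (P k [0..<k])). \<exists>q\<in>roots_on {-B..B} (h k s [0..<k]). \<bar>q - p\<bar> < 1)))"
    by (intro eventually_conj[OF small] eventually_ball_finite ballI eventually_conj[OF _ roots] signs
        finite_col_seqs) auto
  from eventually_happens'[OF trivial_limit_at_right_real this]
  obtain s where s: "0 < s" "s * B < r" and sk: "\<forall>k\<in>{1..n - 1}.
      (\<forall>xs\<in>col_seqs n k. 0 < h k s xs B \<and> 0 < (-1) ^ codepth n xs * h k s xs (- B)) \<and>
        (finite (roots_on {-B..B} (h k s [0..<k])) \<and>
        card (roots_on {-B..B} (h k s [0..<k])) = card (roots_on {-B..B} (poly (P k [0..<k]))) \<and>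
        (\<forall>t\<in>roots_on {-B..B} (h k s [0..<k]). h' k s t \<noteq> 0) \<and>
        (\<forall>p\<in>roots_on {-B..B} (poly (P k [0..<k])). \<exists>q\<in>roots_on {-B..B} (h k s [0..<k]). \<bar>q - p\<bar> < 1))"
    by (elim exE conjE)
  \<comment> \<open>back to the original time scale\<close>
  define a b where "a = t0 - s * B" and "b = t0 + s * B"
  have "fully_split a b (K s)"
    unfolding fully_split_def
  proof (intro conjI ballI)
    show "K s \<in> Lo1 n" by (rule K[OF s(1)])
    fix k assume k: "k \<in> {1..n - 1}"
    note sk = bspec[OF sk k]
    let ?m = "\<lambda>t. minor n k (K s * \<Gamma> t) [0..<k]" and ?g = "\<lambda>t. t0 + s * t"
    have g: "?g ((t - t0) / s) = t" for t using s(1) by simp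
    have gI: "?g t \<in> {a..b} \<longleftrightarrow> t \<in> {-B..B}" for t
    proof -
      have "t0 - s * B \<le> t0 + s * t \<longleftrightarrow> s * (- B) \<le> s * t" "t0 + s * t \<le> t0 + s * B \<longleftrightarrow> s * t \<le> s * B"
        by auto
      thus ?thesis using s(1) unfolding a_def b_def atLeastAtMost_iff by (simp only: mult_le_cancel_left_pos)
    qed
    have h0: "h k s [0..<k] t = 0 \<longleftrightarrow> ?m (?g t) = 0" for t using s(1) by (simp add: h_def)
    have img: "roots_on {a..b} ?m = ?g ` roots_on {-B..B} (h k s [0..<k])"
    proof (intro equalityI subsetI)
      fix t assume "t \<in> roots_on {a..b} ?m"
      hence "(t - t0) / s \<in> roots_on {-B..B} (h k s [0..<k])"
        using gI[of "(t - t0) / s"] h0[of "(t - t0) / s"] unfolding g roots_on_def by blast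
      thus "t \<in> ?g ` roots_on {-B..B} (h k s [0..<k])" using g[of t] by (metis imageI)
    next
      fix t assume "t \<in> ?g ` roots_on {-B..B} (h k s [0..<k])"
      thus "t \<in> roots_on {a..b} ?m" using gI h0 unfolding roots_on_def by blast
    qed
    have "inj_on ?g (roots_on {-B..B} (h k s [0..<k]))" using s(1) by (intro inj_onI) simp
    hence "card (roots_on {a..b} ?m) = card (roots_on {-B..B} (h k s [0..<k]))"
      unfolding img by (rule card_image)
    also have "\<dots> = k * (n - k)" using sk P_roots(2)[OF k] P_roots_B[OF k] by simp
    finally show "card (roots_on {a..b} ?m) = k * (n - k)" .
    show "raise n (\<lambda>j. speed j t) (minor n k (K s * \<Gamma> t)) [0..<k] \<noteq> 0" if "t \<in> roots_on {a..b} ?m" for t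
    proof -
      obtain u where u: "u \<in> roots_on {-B..B} (h k s [0..<k])" "t = ?g u"
        using \<open>t \<in> roots_on {a..b} ?m\<close> unfolding img by blast
      have "h' k s u \<noteq> 0" using sk u(1) by blast
      thus ?thesis unfolding h'_def h_def raise_rescale[OF bot[OF k] s(1)] u(2) by simp
    qed
    fix xs assume xs: "xs \<in> col_seqs n k"
    have "0 < h k s xs B" "0 < (-1) ^ codepth n xs * h k s xs (- B)" using sk xs by blast+
    thus "0 < minor n k (K s * \<Gamma> b) xs" "0 < (-1) ^ codepth n xs * minor n k (K s * \<Gamma> a) xs"
      using s(1) by (simp_all add: h_def a_def b_def zero_less_divide_iff)
  qed
  thus thesis using that[of a b "K s"] s B by (simp add: a_def b_def)
qed

abbreviation m_roots :: "real \<Rightarrow> real \<Rightarrow> real mat \<Rightarrow> nat \<Rightarrow> real set" where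
  "m_roots a b L k \<equiv> roots_on {a..b} (\<lambda>t. minor n k (L * \<Gamma> t) [0..<k])"

lemma fully_split_roots_finite:
  assumes "fully_split a b L" "k \<in> {1..n - 1}"
  shows "finite (m_roots a b L k)"
proof -
  have "card (m_roots a b L k) = k * (n - k)" using assms by (simp add: fully_split_def)
  also have "0 < k * (n - k)" using assms(2) by auto
  finally show ?thesis using card_ge_0_finite by blast
qed

text \<open>
  The perturbed matrix \<open>M d\<close> is chosen in such a way that \<open>M d * \<Gamma> s\<close> differs from \<open>L * \<Gamma> s\<close> by a column
  operation on the last column of \<open>m_k1\<close>. At time \<open>s\<close> the minor for \<open>k2\<close> is still zero, the one for \<open>k1\<close> is
  not; its root has moved away from \<open>s\<close>. All other roots move by less than half of their mutual
  distances, so the union gains a point.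
\<close>

lemma fully_split_separate:
  assumes good: "fully_split a b L" and sub: "{a..b} \<subseteq> I" and k12: "k1 \<in> {1..n - 1}" "k2 \<in> {1..n - 1}" "k1 \<noteq> k2"
    and common: "s \<in> m_roots a b L k1" "s \<in> m_roots a b L k2"
  obtains L' where "fully_split a b L'"
    "card (\<Union>k\<in>{1..n - 1}. m_roots a b L k) < card (\<Union>k\<in>{1..n - 1}. m_roots a b L' k)"
proof -
  let ?K = "{1..n - 1}"
  define R where "R = (\<Union>k\<in>?K. m_roots a b L k)"
  have finR: "finite R" unfolding R_def using fully_split_roots_finite[OF good] by (intro finite_UN_I) auto
  have s: "s \<in> {a..b}" "s \<in> I" using common(1) sub by (auto simp: roots_on_def)
  have sR: "s \<in> R" using common(1) k12(1) by (auto simp: R_def)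
  have L: "L \<in> Lo1 n" and Lc: "L \<in> carrier_mat n n" using good by (auto simp: fully_split_def Lo1_def)
  have \<Gamma>c: "\<Gamma> s \<in> Lo1 n" "\<Gamma> s \<in> carrier_mat n n" using curve_Lo1[OF s(2)] by (auto simp: Lo1_def)
  obtain W where W: "W \<in> Lo1 n" "W * \<Gamma> s = 1\<^sub>m n" using mat_inverse_Lo1[OF \<Gamma>c(1)] by blast
  define j where "j = k1 - 1"
  have j: "Suc j < n" and k1: "0 < k1" "k1 < n" using k12 by (auto simp: j_def)
  let ?d = "\<lambda>l. if l = j then 1 else 0 :: real"
  define M where "M d = L * \<Gamma> s * elementary n j d * W" for d
  have LG: "L * \<Gamma> s \<in> Lo1 n" "L * \<Gamma> s * elementary n j d \<in> Lo1 n" for d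
    using Lo1_mult[OF L \<Gamma>c(1)] Lo1_mult[OF Lo1_mult[OF L \<Gamma>c(1)] elementary_Lo1] by blast+
  have M: "M d \<in> Lo1 n" for d unfolding M_def using Lo1_mult[OF LG(2) W(1)] .
  define g where "g k d xs t = minor n k (M d * \<Gamma> t) xs" for k d xs t
  define g0 where "g0 k xs t = minor n k (L * \<Gamma> t) xs" for k xs t
  have g_s: "g k d xs s = g0 k xs s + d * raise n ?d (minor n k (L * \<Gamma> s)) xs"
    if "xs \<in> col_seqs n k" for k d xs
  proof -
    have "M d * \<Gamma> s = L * \<Gamma> s * elementary n j d * (W * \<Gamma> s)"
      unfolding M_def using Lo1_carrier[OF LG(2)] Lo1_carrier[OF W(1)] \<Gamma>c(2) by (rule assoc_mult_mat)
    also have "\<dots> = L * \<Gamma> s * elementary n j d" unfolding W(2) by (rule right_mult_one_mat[OF Lo1_carrier[OF LG(2)]])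
    finally show ?thesis
      unfolding g_def g0_def using minor_mult_elementary[OF Lo1_carrier[OF LG(1)] j that] by simp
  qed
  have bot: "[0..<k] \<in> col_seqs n k" if "k \<in> ?K" for k
    by (rule bottom_cols_in) (use that in auto)
  have split: "g k1 d [0..<k1] s \<noteq> 0" if "d \<noteq> 0" for d
  proof -
    have "raise n (\<lambda>j. speed j s) (minor n k1 (L * \<Gamma> s)) [0..<k1] \<noteq> 0"
      using good k12(1) common(1) unfolding fully_split_def by blast
    hence "minor n k1 (L * \<Gamma> s) (bump [0..<k1] j) \<noteq> 0"
      unfolding raise_bottom[OF k1] j_def by simp
    moreover have "g0 k1 [0..<k1] s = 0" using common(1) by (simp add: roots_on_def g0_def)
    ultimately show ?thesis
      using that unfolding g_s[OF bot[OF k12(1)]] raise_bottom[OF k1] by (simp add: j_def)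
  qed
  have stay: "g k2 d [0..<k2] s = 0" for d
  proof -
    have "raise n ?d (minor n k2 (L * \<Gamma> s)) [0..<k2] = 0"
      using raise_bottom[of k2 n ?d] k12 k1 by (auto simp: j_def)
    moreover have "g0 k2 [0..<k2] s = 0" using common(2) by (simp add: roots_on_def g0_def)
    ultimately show ?thesis unfolding g_s[OF bot[OF k12(2)]] by simp
  qed
  have sys: "chain_system n k {a..b} speed (g k d)" "chain_system n k {a..b} speed (g0 k)" for k d
    unfolding g_def g0_def
    by (rule chain_system_subset[OF chain_system_curve[OF Lo1_carrier[OF M]] sub],
        rule chain_system_subset[OF chain_system_curve[OF Lc] sub])
  have speed_cont: "continuous_on {a..b} (speed l)" if "Suc l < n" for l
    by (rule continuous_on_subset[OF speed_continuous[OF that] sub])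
  have init: "((\<lambda>d. g k d ys s) \<longlongrightarrow> g0 k ys s) (at_right 0)" if "ys \<in> col_seqs n k" for k ys
  proof -
    have "((\<lambda>d. g0 k ys s + d * raise n ?d (minor n k (L * \<Gamma> s)) ys) \<longlongrightarrow>
        g0 k ys s + 0 * raise n ?d (minor n k (L * \<Gamma> s)) ys) (at_right 0)"
      by (intro tendsto_intros)
    thus ?thesis unfolding g_s[OF that] by simp
  qed
  have lim: "uniform_limit {a..b} (\<lambda>d. g k d xs) (g0 k xs) (at_right 0)"
    "uniform_limit {a..b} (\<lambda>d t. raise n (\<lambda>j. speed j t) (\<lambda>ys. g k d ys t) xs)
      (\<lambda>t. raise n (\<lambda>j. speed j t) (\<lambda>ys. g0 k ys t) xs) (at_right 0)"
    if "xs \<in> col_seqs n k" for k xs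
  proof -
    have ev: "\<forall>\<^sub>F d in at_right 0. chain_system n k {a..b} speed (g k d)"
      by (intro always_eventually allI sys(1))
    note lim = chain_system_uniform_limit[OF ev sys(2) s(1) uniform_limit_const speed_cont init that]
    show "uniform_limit {a..b} (\<lambda>d. g k d xs) (g0 k xs) (at_right 0)" by (rule lim(1))
    show "uniform_limit {a..b} (\<lambda>d t. raise n (\<lambda>j. speed j t) (\<lambda>ys. g k d ys t) xs)
      (\<lambda>t. raise n (\<lambda>j. speed j t) (\<lambda>ys. g0 k ys t) xs) (at_right 0)" by (rule lim(2))
  qed
  have ab: "a \<le> b" using s(1) by simp
  have good_sign: "0 < g0 k xs b" "0 < (-1) ^ codepth n xs * g0 k xs a"
    if "k \<in> ?K" "xs \<in> col_seqs n k" for k xs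
    using good that unfolding fully_split_def g0_def by blast+
  have signs: "\<forall>\<^sub>F d in at_right 0. 0 < g k d xs b \<and> 0 < (-1) ^ codepth n xs * g k d xs a"
    if k: "k \<in> ?K" and xs: "xs \<in> col_seqs n k" for k xs
  proof -
    have "((\<lambda>d. g k d xs b) \<longlongrightarrow> g0 k xs b) (at_right 0)"
      using tendsto_uniform_limitI[OF lim(1)[OF xs]] ab by simp
    moreover have "((\<lambda>d. (-1) ^ codepth n xs * g k d xs a) \<longlongrightarrow> (-1) ^ codepth n xs * g0 k xs a) (at_right 0)"
      using tendsto_uniform_limitI[OF lim(1)[OF xs]] ab by (intro tendsto_mult_left) simp
    ultimately show ?thesis
      using good_sign[OF k xs] by (intro eventually_conj order_tendstoD(1))
  qed
  obtain \<eta> where \<eta>: "0 < \<eta>" "\<And>p q. p \<in> R \<Longrightarrow> q \<in> R \<Longrightarrow> p \<noteq> q \<Longrightarrow> 2 * \<eta> < \<bar>p - q\<bar>"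
    using finite_separated[OF finR] by blast
  define g' where "g' k d t = raise n (\<lambda>j. speed j t) (\<lambda>ys. g k d ys t) [0..<k]" for k d t
  have roots: "\<forall>\<^sub>F d in at_right 0. finite (roots_on {a..b} (g k d [0..<k])) \<and>
      card (roots_on {a..b} (g k d [0..<k])) = card (roots_on {a..b} (g0 k [0..<k])) \<and>
      (\<forall>t\<in>roots_on {a..b} (g k d [0..<k]). g' k d t \<noteq> 0) \<and>
      (\<forall>p\<in>roots_on {a..b} (g0 k [0..<k]). \<exists>q\<in>roots_on {a..b} (g k d [0..<k]). \<bar>q - p\<bar> < \<eta>)"
    if k: "k \<in> ?K" for k
  proof (rule simple_roots_stable[where f' = "\<lambda>t. raise n (\<lambda>j. speed j t) (\<lambda>ys. g0 k ys t) [0..<k]"])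
    show "(g0 k [0..<k] has_real_derivative raise n (\<lambda>j. speed j t) (\<lambda>ys. g0 k ys t) [0..<k]) (at t within {a..b})"
      if "t \<in> {a..b}" for t by (rule chain_systemD[OF sys(2) bot[OF k] that])
    show "continuous_on {a..b} (\<lambda>t. raise n (\<lambda>j. speed j t) (\<lambda>ys. g0 k ys t) [0..<k])"
      unfolding raise_def
    proof (intro continuous_intros)
      fix p assume p: "p \<in> bumps n [0..<k]"
      show "continuous_on {a..b} (\<lambda>t. speed ([0..<k] ! p) t)"
        by (rule speed_cont[OF bump_col_seqs(3)[OF bot[OF k] p]])
      show "continuous_on {a..b} (\<lambda>t. g0 k (bump [0..<k] p) t)"
        by (rule chain_system_continuous[OF sys(2) bump_col_seqs(2)[OF bot[OF k] p]])
    qed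
    show "g0 k [0..<k] a \<noteq> 0" "g0 k [0..<k] b \<noteq> 0"
      using good_sign[OF k bot[OF k]] by auto
    show "finite (roots_on {a..b} (g0 k [0..<k]))"
      unfolding g0_def by (rule fully_split_roots_finite[OF good k])
    show "raise n (\<lambda>j. speed j t) (\<lambda>ys. g0 k ys t) [0..<k] \<noteq> 0" if "t \<in> roots_on {a..b} (g0 k [0..<k])" for t
      using good k that unfolding fully_split_def g0_def by blast
    show "\<forall>\<^sub>F d in at_right 0. \<forall>t\<in>{a..b}. (g k d [0..<k] has_real_derivative g' k d t) (at t within {a..b})"
      unfolding g'_def by (intro always_eventually allI ballI chain_systemD[OF sys(1) bot[OF k]])
    show "uniform_limit {a..b} (\<lambda>d. g k d [0..<k]) (g0 k [0..<k]) (at_right 0)"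
      by (rule lim(1)[OF bot[OF k]])
    show "uniform_limit {a..b} (g' k) (\<lambda>t. raise n (\<lambda>j. speed j t) (\<lambda>ys. g0 k ys t) [0..<k]) (at_right 0)"
      unfolding g'_def by (rule lim(2)[OF bot[OF k]])
  qed (rule \<eta>(1))
  have pos: "\<forall>\<^sub>F d in at_right (0::real). 0 < d" by (simp add: eventually_at_right_less)
  have "\<forall>\<^sub>F d in at_right 0. 0 < d \<and> (\<forall>k\<in>?K.
      (\<forall>xs\<in>col_seqs n k. 0 < g k d xs b \<and> 0 < (-1) ^ codepth n xs * g k d xs a) \<and>
      (finite (roots_on {a..b} (g k d [0..<k])) \<and>
      card (roots_on {a..b} (g k d [0..<k])) = card (roots_on {a..b} (g0 k [0..<k])) \<and>
      (\<forall>t\<in>roots_on {a..b} (g k d [0..<k]). g' k d t \<noteq> 0) \<and>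
      (\<forall>p\<in>roots_on {a..b} (g0 k [0..<k]). \<exists>q\<in>roots_on {a..b} (g k d [0..<k]). \<bar>q - p\<bar> < \<eta>)))"
    by (intro eventually_conj[OF pos] eventually_ball_finite ballI eventually_conj[OF _ roots] signs
        finite_col_seqs) auto
  from eventually_happens'[OF trivial_limit_at_right_real this]
  obtain d where d: "0 < d" and dk: "\<forall>k\<in>?K.
      (\<forall>xs\<in>col_seqs n k. 0 < g k d xs b \<and> 0 < (-1) ^ codepth n xs * g k d xs a) \<and>
      (finite (roots_on {a..b} (g k d [0..<k])) \<and>
      card (roots_on {a..b} (g k d [0..<k])) = card (roots_on {a..b} (g0 k [0..<k])) \<and>
      (\<forall>t\<in>roots_on {a..b} (g k d [0..<k]). g' k d t \<noteq> 0) \<and>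
      (\<forall>p\<in>roots_on {a..b} (g0 k [0..<k]). \<exists>q\<in>roots_on {a..b} (g k d [0..<k]). \<bar>q - p\<bar> < \<eta>))"
    by (elim exE conjE)
  have good': "fully_split a b (M d)"
    unfolding fully_split_def
  proof (intro conjI ballI M)
    fix k assume k: "k \<in> ?K"
    note dk = bspec[OF dk k]
    have "card (m_roots a b L k) = k * (n - k)" using good k by (simp add: fully_split_def)
    thus "card (m_roots a b (M d) k) = k * (n - k)" using dk unfolding g_def g0_def by simp
    show "raise n (\<lambda>j. speed j t) (minor n k (M d * \<Gamma> t)) [0..<k] \<noteq> 0" if "t \<in> m_roots a b (M d) k" for t
      using dk that unfolding g'_def g_def by blast
    fix xs assume "xs \<in> col_seqs n k"
    thus "0 < minor n k (M d * \<Gamma> b) xs" "0 < (-1) ^ codepth n xs * minor n k (M d * \<Gamma> a) xs"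
      using dk unfolding g_def by blast+
  qed
  define R' where "R' = (\<Union>k\<in>?K. m_roots a b (M d) k)"
  have finR': "finite R'" unfolding R'_def using fully_split_roots_finite[OF good'] by (intro finite_UN_I) auto
  have near: "\<exists>q\<in>m_roots a b (M d) k. \<bar>q - p\<bar> < \<eta>" if "k \<in> ?K" "p \<in> m_roots a b L k" for k p
    using bspec[OF dk that(1)] that(2) unfolding g_def g0_def by blast
  have "\<exists>q. q \<in> R' \<and> \<bar>q - p\<bar> < \<eta> \<and> (p = s \<longrightarrow> q = s)" if p: "p \<in> R" for p
  proof (cases "p = s")
    case True
    have "s \<in> m_roots a b (M d) k2" using stay s(1) by (simp add: roots_on_def g_def)
    hence "s \<in> R'" using k12(2) by (auto simp: R'_def)
    thus ?thesis using True \<eta>(1) by auto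
  next
    case False
    obtain k where k: "k \<in> ?K" "p \<in> m_roots a b L k" using p unfolding R_def by blast
    obtain q where "q \<in> m_roots a b (M d) k" "\<bar>q - p\<bar> < \<eta>" using near[OF k] by blast
    thus ?thesis using k(1) False unfolding R'_def by blast
  qed
  then obtain \<sigma> where \<sigma>: "\<And>p. p \<in> R \<Longrightarrow> \<sigma> p \<in> R' \<and> \<bar>\<sigma> p - p\<bar> < \<eta> \<and> (p = s \<longrightarrow> \<sigma> p = s)" by metis
  \<comment> \<open>the displaced root of the minor for \<open>k1\<close>, the additional point of the union\<close>
  obtain q where q: "q \<in> m_roots a b (M d) k1" "\<bar>q - s\<bar> < \<eta>" using near[OF k12(1) common(1)] by blast
  have "q \<noteq> s"
  proof
    assume "q = s"
    hence "g k1 d [0..<k1] s = 0" using q(1) by (simp add: roots_on_def g_def)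
    thus False using split d by simp
  qed
  have "inj_on \<sigma> R"
  proof (rule inj_onI, rule ccontr)
    fix p p' assume pp: "p \<in> R" "p' \<in> R" "\<sigma> p = \<sigma> p'" "p \<noteq> p'"
    have "2 * \<eta> < \<bar>p - p'\<bar>" using \<eta>(2)[OF pp(1,2,4)] .
    moreover have "\<bar>\<sigma> p - p\<bar> < \<eta>" "\<bar>\<sigma> p' - p'\<bar> < \<eta>" using \<sigma>[OF pp(1)] \<sigma>[OF pp(2)] by blast+
    ultimately show False using pp(3) by linarith
  qed
  have "q \<notin> \<sigma> ` R"
  proof
    assume "q \<in> \<sigma> ` R"
    then obtain p where p: "p \<in> R" "q = \<sigma> p" by blast
    have "p \<noteq> s" using \<sigma>[OF p(1)] p(2) \<open>q \<noteq> s\<close> by blast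
    hence "2 * \<eta> < \<bar>p - s\<bar>" using \<eta>(2)[OF p(1) sR] by blast
    moreover have "\<bar>\<sigma> p - p\<bar> < \<eta>" using \<sigma>[OF p(1)] by blast
    ultimately show False using q(2) p(2) by linarith
  qed
  have "q \<in> R'" using q(1) k12(1) unfolding R'_def by blast
  have "card R < card (insert q (\<sigma> ` R))"
    using \<open>q \<notin> \<sigma> ` R\<close> finR card_image[OF \<open>inj_on \<sigma> R\<close>] by simp
  also have "\<dots> \<le> card R'" using \<sigma> \<open>q \<in> R'\<close> by (intro card_mono finR') blast
  finally show thesis using that[OF good'] by (simp add: R_def R'_def)
qed

text \<open>
  The number of distinct roots is bounded by the sum of the \<open>k * (n - k)\<close>, so it attains a maximum, where
  \<open>fully_split_separate\<close> cannot apply.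
\<close>

lemma fully_split_disjoint_near:
  assumes r: "0 < r" and sub: "{t0 - r..t0 + r} \<subseteq> I"
  obtains a b L where "t0 - r \<le> a" "a < b" "b \<le> t0 + r" "fully_split a b L"
    "\<And>k1 k2. k1 \<in> {1..n - 1} \<Longrightarrow> k2 \<in> {1..n - 1} \<Longrightarrow> k1 \<noteq> k2 \<Longrightarrow> m_roots a b L k1 \<inter> m_roots a b L k2 = {}"
proof -
  let ?K = "{1..n - 1}"
  obtain a b L0 where ab: "t0 - r \<le> a" "a < b" "b \<le> t0 + r" and L0: "fully_split a b L0"
    using fully_split_near[OF r sub] by blast
  have abI: "{a..b} \<subseteq> I" using ab sub by (auto simp: subset_iff)
  define f where "f L = card (\<Union>k\<in>?K. m_roots a b L k)" for L
  have bound: "\<forall>L. fully_split a b L \<longrightarrow> f L < Suc (\<Sum>k\<in>?K. k * (n - k))"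
  proof (intro allI impI)
    fix L assume L: "fully_split a b L"
    have "f L \<le> (\<Sum>k\<in>?K. card (m_roots a b L k))" unfolding f_def by (rule card_UN_le) simp
    also have "\<dots> = (\<Sum>k\<in>?K. k * (n - k))" using L by (intro sum.cong refl) (auto simp: fully_split_def)
    finally show "f L < Suc (\<Sum>k\<in>?K. k * (n - k))" by simp
  qed
  obtain L where L: "fully_split a b L" and max: "\<forall>L'. fully_split a b L' \<longrightarrow> f L' \<le> f L"
    using ex_has_greatest_nat[OF L0 bound] by blast
  have "m_roots a b L k1 \<inter> m_roots a b L k2 = {}" if k: "k1 \<in> ?K" "k2 \<in> ?K" "k1 \<noteq> k2" for k1 k2
  proof (rule ccontr)
    assume "m_roots a b L k1 \<inter> m_roots a b L k2 \<noteq> {}"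
    then obtain s where s: "s \<in> m_roots a b L k1" "s \<in> m_roots a b L k2" by blast
    obtain L' where "fully_split a b L'" "f L < f L'"
      using fully_split_separate[OF L abI k s] unfolding f_def by blast
    thus False using max by fastforce
  qed
  thus thesis using that ab L by blast
qed

text \<open>
  This is where the roots on all of \<open>I\<close> are controlled: the positivity at \<open>b\<close> propagates to the right end
  of \<open>I\<close>, and the alternating signs at \<open>a\<close> propagate to the left end.
\<close>

lemma fully_split_roots_outside:
  assumes good: "fully_split a b L" and sub: "{a..b} \<subseteq> I" and ab: "a < b" and k: "k \<in> {1..n - 1}"
  shows "roots_on I (\<lambda>t. minor n k (L * \<Gamma> t) [0..<k]) = m_roots a b L k"
    and "m_roots a b L k \<subseteq> {a<..<b}"
proof -
  have bot: "[0..<k] \<in> col_seqs n k" by (rule bottom_cols_in) (use k in auto)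
  have aI: "a \<in> I" "b \<in> I" using sub ab by auto
  have Lc: "L \<in> carrier_mat n n" using good by (auto simp: fully_split_def Lo1_def)
  note sys = chain_system_curve[OF Lc]
  have speed: "0 \<le> speed j t" if "Suc j < n" "t \<in> I" for j t using speed_pos[OF that] by simp
  have pos: "0 < minor n k (L * \<Gamma> b) xs" "0 < (-1) ^ codepth n xs * minor n k (L * \<Gamma> a) xs"
    if "xs \<in> col_seqs n k" for xs
    using good k that unfolding fully_split_def by blast+
  have right: "minor n k (L * \<Gamma> t) [0..<k] \<noteq> 0" if t: "t \<in> I" "b \<le> t" for t
    using chain_system_pos_right[OF sys interval aI(2) t speed pos(1) bot] by simp
  have left: "minor n k (L * \<Gamma> t) [0..<k] \<noteq> 0" if t: "t \<in> I" "t \<le> a" for t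
    using chain_system_pos_left[OF sys interval aI(1) t speed pos(2) bot] by auto
  have inside: "a < t \<and> t < b" if "t \<in> I" "minor n k (L * \<Gamma> t) [0..<k] = 0" for t
    using right[OF that(1)] left[OF that(1)] that(2) by force
  show "roots_on I (\<lambda>t. minor n k (L * \<Gamma> t) [0..<k]) = m_roots a b L k"
  proof (intro equalityI subsetI)
    fix t assume "t \<in> roots_on I (\<lambda>t. minor n k (L * \<Gamma> t) [0..<k])"
    thus "t \<in> m_roots a b L k" using inside[of t] by (simp add: roots_on_def)
  qed (use sub in \<open>auto simp: roots_on_def\<close>)
  show "m_roots a b L k \<subseteq> {a<..<b}"
  proof
    fix t assume "t \<in> m_roots a b L k"
    thus "t \<in> {a<..<b}" using inside[of t] sub by (auto simp: roots_on_def)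
  qed
qed

end

theorem theorem2:
  fixes n :: nat and I I\<^sub>1 :: "real set" and \<Gamma> :: "real \<Rightarrow> real mat"
  assumes "n \<ge> 2"
    and "is_interval I" and "\<exists>a\<in>I. \<exists>b\<in>I. a < b"
    and "flag_convex n I \<Gamma>"
    and "is_interval I\<^sub>1" and "open I\<^sub>1" and "I\<^sub>1 \<noteq> {}" and "I\<^sub>1 \<subseteq> I"
  shows "\<exists>L\<^sub>1 \<in> Lo1 n.
    (let m = m_curve (\<lambda>t. L\<^sub>1 * \<Gamma> t) in
      (\<forall>k\<in>{1..n-1}. \<forall>t\<in>roots_on I (m k). simple_root_on I (m k) t \<and> t \<in> I\<^sub>1) \<and>
      (\<forall>k\<^sub>1\<in>{1..n-1}. \<forall>k\<^sub>2\<in>{1..n-1}. k\<^sub>1 \<noteq> k\<^sub>2 \<longrightarrow>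
         roots_on I (m k\<^sub>1) \<inter> roots_on I (m k\<^sub>2) = {}) \<and>
      (\<forall>k\<in>{1..n-1}. finite (roots_on I (m k)) \<and> card (roots_on I (m k)) = k * (n - k)))"
proof -
  interpret flag_convex_curve n I \<Gamma> by unfold_locales (fact assms)+
  obtain t0 where t0: "t0 \<in> I\<^sub>1" using assms(7) by blast
  then obtain r where r: "0 < r" "cball t0 r \<subseteq> I\<^sub>1" using assms(6) open_contains_cball by blast
  have cball: "cball t0 r = {t0 - r..t0 + r}" by (auto simp: cball_def dist_real_def)
  hence sub: "{t0 - r..t0 + r} \<subseteq> I" using r(2) assms(8) by blast
  obtain a b L where ab: "t0 - r \<le> a" "a < b" "b \<le> t0 + r" and good: "fully_split a b L"
    and disjoint: "\<And>k1 k2. k1 \<in> {1..n - 1} \<Longrightarrow> k2 \<in> {1..n - 1} \<Longrightarrow> k1 \<noteq> k2 \<Longrightarrow>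
      m_roots a b L k1 \<inter> m_roots a b L k2 = {}"
    using fully_split_disjoint_near[OF r(1) sub] by blast
  have abI1: "{a..b} \<subseteq> I\<^sub>1" using ab r(2) unfolding cball by (auto simp: subset_iff)
  hence abI: "{a..b} \<subseteq> I" using assms(8) by blast
  have L: "L \<in> Lo1 n" and Lc: "L \<in> carrier_mat n n" using good by (auto simp: fully_split_def Lo1_def)
  let ?m = "m_curve (\<lambda>t. L * \<Gamma> t)"
  have m: "?m k t = minor n k (L * \<Gamma> t) [0..<k]" if "k \<in> {1..n - 1}" "t \<in> I" for k t
    unfolding m_curve_def using that Lc Lo1_carrier[OF curve_Lo1[OF that(2)]]
    by (intro minor_swminor) auto
  have roots: "roots_on I (?m k) = m_roots a b L k" if k: "k \<in> {1..n - 1}" for k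
  proof -
    have "roots_on I (?m k) = roots_on I (\<lambda>t. minor n k (L * \<Gamma> t) [0..<k])"
      using m[OF k] by (auto simp: roots_on_def)
    thus ?thesis using fully_split_roots_outside(1)[OF good abI ab(2) k] by simp
  qed
  have "simple_root_on I (?m k) t \<and> t \<in> I\<^sub>1" if k: "k \<in> {1..n - 1}" and t: "t \<in> m_roots a b L k" for k t
  proof -
    have bot: "[0..<k] \<in> col_seqs n k" by (rule bottom_cols_in) (use k in auto)
    have tab: "t \<in> {a..b}" "minor n k (L * \<Gamma> t) [0..<k] = 0" using t by (auto simp: roots_on_def)
    have tI: "t \<in> I" using tab abI by blast
    let ?d = "raise n (\<lambda>j. speed j t) (minor n k (L * \<Gamma> t)) [0..<k]"
    have "((\<lambda>t. minor n k (L * \<Gamma> t) [0..<k]) has_real_derivative ?d) (at t within I)"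
      by (rule chain_systemD[OF chain_system_curve[OF Lc] bot tI])
    hence "(?m k has_real_derivative ?d) (at t within I)"
      unfolding has_field_derivative_def
      by (rule has_derivative_transform[OF tI, rotated]) (rule m[OF k])
    moreover have "?d \<noteq> 0" using good k t unfolding fully_split_def by blast
    ultimately show ?thesis
      using tab tI m[OF k tI] abI1 unfolding simple_root_on_def by auto
  qed
  moreover have "finite (m_roots a b L k) \<and> card (m_roots a b L k) = k * (n - k)" if "k \<in> {1..n - 1}" for k
    using fully_split_roots_finite[OF good that] good that by (simp add: fully_split_def)
  ultimately show ?thesis
    unfolding Let_def using roots disjoint by (intro bexI[OF _ L]) simp
qed

end
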